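(* Let $V$ be a finite tree metric space for a positively weighted tree $T=(V,E)$, whose vertices are totally ordered in a way compatible with $T$. Then the apparent pairs gradient for the lexicographically refined Vietoris–Rips filtration (i.e. the collection of apparent pairs of $\operatorname{Cl}(V)$ with respect to the $\operatorname{diam}$-lexicographic order) induces a sequence of collapses $$\operatorname{Rips}_u(V)\searrow \operatorname{Rips}_t(V)\searrow T_t$$ for every $u>t>0$ such that no edge $e\in E$ has length $l(e)\in(t,u]$, where $T_t$ is the subforest with vertices $V$ and all edges of $E$ with length at most $t$. In particular, the persistent homology of the Vietoris–Rips filtration $(\operatorname{Rips}_t(V))_{t}$ is trivial in degree $>0$.
   Context: Tree metric: $T=(V,E)$ is a finite tree with positive edge weights $l(e)$, $e\in E$, and $d(x,y)$ is the total weight of the shortest path from $x$ to $y$ in $T$. A total order on $V$ is compatible with $T$ if, for some choice of root vertex, it extends the tree partial order in which $u$ is smaller than or equal to $w$ when $u$ lies on the path from the root to $w$ (so the root is minimal). $\operatorname{Rips}_t(V)=\{\emptyset\neq S\subseteq V\mid \operatorname{diam}S\leq t\}$; $\operatorname{Cl}(V)$ is the full simplicial complex of all nonempty subsets of $V$. The forest $T_t$ is regarded as a simplicial complex (all vertices together with the given edges). Given the total order on $V$, the $\operatorname{diam}$-lexicographic order on $\operatorname{Cl}(V)$ orders simplices first by diameter, then by dimension, then lexicographically (comparing vertices listed in increasing order). A facet of $\tau$ is a face of codimension one; $\tau$ is then a cofacet. A pair $(\sigma,\tau)$ is an apparent pair if $\sigma$ is the maximal facet of $\tau$ and $\tau$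 is the minimal cofacet of $\sigma$ with respect to this order. The collection of apparent pairs, each viewed as the interval $\{\sigma,\tau\}$ in the face poset, is a discrete gradient (the apparent pairs gradient). Discrete gradients: for a complex $K$ and $\rho\subseteq\phi$ in $K$ put $[\rho,\phi]=\{\psi\in K\mid \rho\subseteq\psi\subseteq\phi\}$. A monotonic function $f\colon K\to\mathbb R$ is a discrete Morse function if there is a partition of $K$ into intervals such that for $\sigma\subseteq\tau$ one has $f(\sigma)=f(\tau)$ iff $\sigma,\tau$ lie in a common interval; its discrete gradient is the collection of the intervals with $\rho\neq\phi$ (regular intervals). An elementary collapse removes a pair of simplices $\sigma,\tau$ with $\sigma$ a facet of $\tau$ and $\tau$ the unique proper coface of $\sigma$; a collapse $K\searrow L$ is a finite sequence of elementary collapses. A discrete gradient $W$ on a finite complex $M$ induces a collapse $K\searrow L$ between subcomplexes $L\subseteq K\subseteq M$ if $K\setminus L$ is a union of (regular) intervals of $W$ and $K$ collapses to $L$. *)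

theory Defs
  imports Complex_Main "HOL-Library.Disjoint_Sets" "HOL-Algebra.Elementary_Groups"
begin

section \<open>Weighted trees, tree metrics and compatible vertex orders\<close>

text \<open>A graph is given by a vertex set \<open>V\<close> and a set \<open>E\<close> of two-element subsets of \<open>V\<close>.
  A path is the list of its (pairwise distinct) vertices.\<close>

definition path :: "'a set \<Rightarrow> 'a set set \<Rightarrow> 'a \<Rightarrow> 'a list \<Rightarrow> 'a \<Rightarrow> bool" where
  "path V E x xs y \<longleftrightarrow> xs \<noteq> [] \<and> hd xs = x \<and> last xs = y \<and> set xs \<subseteq> V \<and> distinct xs \<and>
     successively (\<lambda>u v. {u, v} \<in> E) xs"

definition cycle :: "'a set set \<Rightarrow> 'a list \<Rightarrow> bool" where
  "cycle E xs \<longleftrightarrow> 3 \<le> length xs \<and> distinct xs \<and> successively (\<lambda>u v. {u, v} \<in> E) xs \<and>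
     {last xs, hd xs} \<in> E"

definition finite_tree :: "'a set \<Rightarrow> 'a set set \<Rightarrow> bool" where
  "finite_tree V E \<longleftrightarrow> finite V \<and> V \<noteq> {} \<and> (\<forall>e\<in>E. e \<subseteq> V \<and> card e = 2) \<and>
     (\<forall>x\<in>V. \<forall>y\<in>V. \<exists>xs. path V E x xs y) \<and> (\<nexists>xs. cycle E xs)"

definition path_weight :: "('a set \<Rightarrow> real) \<Rightarrow> 'a list \<Rightarrow> real" where
  "path_weight l xs = sum_list (map2 (\<lambda>u v. l {u, v}) xs (tl xs))"

definition tree_dist :: "'a set \<Rightarrow> 'a set set \<Rightarrow> ('a set \<Rightarrow> real) \<Rightarrow> 'a \<Rightarrow> 'a \<Rightarrow> real" where
  "tree_dist V E l x y = Min (path_weight l ` {xs. path V E x xs y})"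

definition root_le :: "'a set \<Rightarrow> 'a set set \<Rightarrow> 'a \<Rightarrow> 'a \<Rightarrow> 'a \<Rightarrow> bool" where
  "root_le V E r u w \<longleftrightarrow> (\<exists>xs. path V E r xs w \<and> u \<in> set xs)"

text \<open>The total order on \<open>V\<close> is the restriction of the order of the ambient linearly ordered type.\<close>

definition compatible_order :: "'a::linorder set \<Rightarrow> 'a set set \<Rightarrow> bool" where
  "compatible_order V E \<longleftrightarrow>
     (\<exists>r\<in>V. \<forall>u\<in>V. \<forall>w\<in>V. root_le V E r u w \<longrightarrow> u \<le> w)"


section \<open>Simplicial complexes\<close>

definition simplicial_complex :: "'a set set \<Rightarrow> bool" where
  "simplicial_complex K \<longleftrightarrow>
     (\<forall>\<sigma>\<in>K. finite \<sigma> \<and> \<sigma> \<noteq> {} \<and> (\<forall>\<rho>. \<rho> \<noteq> {} \<and> \<rho> \<subseteq> \<sigma> \<longrightarrow> \<rho> \<in> K))"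

definition subcomplex :: "'a set set \<Rightarrow> 'a set set \<Rightarrow> bool" where
  "subcomplex L K \<longleftrightarrow> simplicial_complex L \<and> simplicial_complex K \<and> L \<subseteq> K"

definition full_complex :: "'a set \<Rightarrow> 'a set set" where
  "full_complex V = {S. S \<noteq> {} \<and> S \<subseteq> V}"

definition diam :: "('a \<Rightarrow> 'a \<Rightarrow> real) \<Rightarrow> 'a set \<Rightarrow> real" where
  "diam d S = Max {d x y |x y. x \<in> S \<and> y \<in> S}"

definition Rips :: "('a \<Rightarrow> 'a \<Rightarrow> real) \<Rightarrow> 'a set \<Rightarrow> real \<Rightarrow> 'a set set" where
  "Rips d V t = {S. S \<noteq> {} \<and> S \<subseteq> V \<and> diam d S \<le> t}"

definition subforest :: "'a set \<Rightarrow> 'a set set \<Rightarrow> ('a set \<Rightarrow> real) \<Rightarrow> real \<Rightarrow> 'a set set" where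
  "subforest V E l t = (\<lambda>v. {v}) ` V \<union> {e \<in> E. l e \<le> t}"

definition facet :: "'a set \<Rightarrow> 'a set \<Rightarrow> bool" where
  "facet \<sigma> \<tau> \<longleftrightarrow> \<sigma> \<noteq> {} \<and> \<sigma> \<subseteq> \<tau> \<and> card \<tau> = card \<sigma> + 1"

definition elementary_collapse :: "'a set set \<Rightarrow> 'a set set \<Rightarrow> bool" where
  "elementary_collapse K L \<longleftrightarrow>
     (\<exists>\<sigma> \<tau>. \<sigma> \<in> K \<and> \<tau> \<in> K \<and> facet \<sigma> \<tau> \<and> (\<forall>\<rho>\<in>K. \<sigma> \<subset> \<rho> \<longrightarrow> \<rho> = \<tau>) \<and> L = K - {\<sigma>, \<tau>})"

definition collapses :: "'a set set \<Rightarrow> 'a set set \<Rightarrow> bool" where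
  "collapses = elementary_collapse\<^sup>*\<^sup>*"


section \<open>Discrete gradients\<close>

definition face_interval :: "'a set set \<Rightarrow> 'a set \<Rightarrow> 'a set \<Rightarrow> 'a set set" where
  "face_interval K \<rho> \<phi> = {\<psi> \<in> K. \<rho> \<subseteq> \<psi> \<and> \<psi> \<subseteq> \<phi>}"

definition interval_partition :: "'a set set \<Rightarrow> 'a set set set \<Rightarrow> bool" where
  "interval_partition K P \<longleftrightarrow> partition_on K P \<and>
     (\<forall>I\<in>P. \<exists>\<rho>\<in>K. \<exists>\<phi>\<in>K. \<rho> \<subseteq> \<phi> \<and> I = face_interval K \<rho> \<phi>)"

definition morse_function_for :: "'a set set \<Rightarrow> 'a set set set \<Rightarrow> ('a set \<Rightarrow> real) \<Rightarrow> bool" where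
  "morse_function_for K P f \<longleftrightarrow> interval_partition K P \<and>
     (\<forall>\<sigma>\<in>K. \<forall>\<tau>\<in>K. \<sigma> \<subseteq> \<tau> \<longrightarrow>
        f \<sigma> \<le> f \<tau> \<and> (f \<sigma> = f \<tau> \<longleftrightarrow> (\<exists>I\<in>P. \<sigma> \<in> I \<and> \<tau> \<in> I)))"

definition regular_intervals :: "'a set set \<Rightarrow> 'a set set set \<Rightarrow> 'a set set set" where
  "regular_intervals K P =
     {I \<in> P. \<exists>\<rho>\<in>K. \<exists>\<phi>\<in>K. \<rho> \<subseteq> \<phi> \<and> \<rho> \<noteq> \<phi> \<and> I = face_interval K \<rho> \<phi>}"

definition discrete_gradient :: "'a set set \<Rightarrow> 'a set set set \<Rightarrow> bool" where
  "discrete_gradient K W \<longleftrightarrow> (\<exists>P f. morse_function_for K P f \<and> W = regular_intervals K P)"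

definition induces_collapse ::
    "'a set set \<Rightarrow> 'a set set set \<Rightarrow> 'a set set \<Rightarrow> 'a set set \<Rightarrow> bool" where
  "induces_collapse M W K L \<longleftrightarrow>
     finite M \<and> discrete_gradient M W \<and> subcomplex L K \<and> subcomplex K M \<and>
     (\<exists>W'\<subseteq>W. K - L = \<Union>W') \<and> collapses K L"


section \<open>Apparent pairs\<close>

definition diam_lex_less :: "('a::linorder \<Rightarrow> 'a \<Rightarrow> real) \<Rightarrow> 'a set \<Rightarrow> 'a set \<Rightarrow> bool" where
  "diam_lex_less d \<sigma> \<tau> \<longleftrightarrow>
     diam d \<sigma> < diam d \<tau> \<or>
     diam d \<sigma> = diam d \<tau> \<and>
       (card \<sigma> < card \<tau> \<or>
        card \<sigma> = card \<tau> \<and>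
          (sorted_list_of_set \<sigma>, sorted_list_of_set \<tau>) \<in> lexord {(x, y). x < y})"

definition apparent_pair ::
    "('a::linorder \<Rightarrow> 'a \<Rightarrow> real) \<Rightarrow> 'a set set \<Rightarrow> 'a set \<Rightarrow> 'a set \<Rightarrow> bool" where
  "apparent_pair d K \<sigma> \<tau> \<longleftrightarrow> \<sigma> \<in> K \<and> \<tau> \<in> K \<and> facet \<sigma> \<tau> \<and>
     (\<forall>\<rho>\<in>K. facet \<rho> \<tau> \<and> \<rho> \<noteq> \<sigma> \<longrightarrow> diam_lex_less d \<rho> \<sigma>) \<and>
     (\<forall>\<psi>\<in>K. facet \<sigma> \<psi> \<and> \<psi> \<noteq> \<tau> \<longrightarrow> diam_lex_less d \<tau> \<psi>)"

definition apparent_pairs_gradient ::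
    "('a::linorder \<Rightarrow> 'a \<Rightarrow> real) \<Rightarrow> 'a set \<Rightarrow> 'a set set set" where
  "apparent_pairs_gradient d V =
     {{\<sigma>, \<tau>} |\<sigma> \<tau>. apparent_pair d (full_complex V) \<sigma> \<tau>}"


section \<open>Simplicial homology and persistent homology\<close>

text \<open>Simplicial homology (unreduced) with coefficients in a commutative ring, with simplices
  oriented by the order of the vertices. A chain is a finitely supported function on simplices.
  A set with \<open>p + 1\<close> vertices is a \<open>p\<close>-simplex.\<close>

definition chain_group :: "'a set set \<Rightarrow> nat \<Rightarrow> ('a set \<Rightarrow> 'k::comm_ring_1) monoid" where
  "chain_group K p =
     \<lparr>carrier = {c. finite {\<sigma>. c \<sigma> \<noteq> 0} \<and> {\<sigma>. c \<sigma> \<noteq> 0} \<subseteq> {\<sigma> \<in> K. card \<sigma> = p + 1}},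
      mult = (\<lambda>c c' \<sigma>. c \<sigma> + c' \<sigma>), one = (\<lambda>_. 0)\<rparr>"

text \<open>Removing from \<open>\<tau>\<close> the vertex that is preceded by exactly \<open>i\<close> vertices of \<open>\<tau>\<close>
  contributes with the sign \<open>(- 1) ^ i\<close>.\<close>

definition incidence :: "'a::linorder set \<Rightarrow> 'a set \<Rightarrow> 'k::comm_ring_1" where
  "incidence \<tau> \<sigma> =
     (if facet \<sigma> \<tau> then (- 1) ^ card {w \<in> \<tau>. \<forall>v \<in> \<tau> - \<sigma>. w < v} else 0)"

definition boundary :: "('a::linorder set \<Rightarrow> 'k::comm_ring_1) \<Rightarrow> 'a set \<Rightarrow> 'k" where
  "boundary c \<sigma> = (\<Sum>\<tau> | c \<tau> \<noteq> 0. c \<tau> * incidence \<tau> \<sigma>)"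

definition cycle_group :: "'a::linorder set set \<Rightarrow> nat \<Rightarrow> ('a set \<Rightarrow> 'k::comm_ring_1) monoid" where
  "cycle_group K p =
     (chain_group K p)\<lparr>carrier := {c \<in> carrier (chain_group K p). boundary c = (\<lambda>_. 0)}\<rparr>"

definition boundaries :: "'a::linorder set set \<Rightarrow> nat \<Rightarrow> ('a set \<Rightarrow> 'k::comm_ring_1) set" where
  "boundaries K p = boundary ` carrier (chain_group K (p + 1))"

definition homology_group ::
    "'a::linorder set set \<Rightarrow> nat \<Rightarrow> ('a set \<Rightarrow> 'k::comm_ring_1) set monoid" where
  "homology_group K p = cycle_group K p Mod boundaries K p"

text \<open>For \<open>K \<subseteq> L\<close>, the map from the \<open>p\<close>-th homology of \<open>K\<close> to that of \<open>L\<close> induced by the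
  inclusion: it sends the class of a cycle \<open>z\<close> of \<open>K\<close>, i.e. the coset of \<open>z\<close> with respect
  to the boundaries of \<open>K\<close>, to the coset of \<open>z\<close> with respect to the boundaries of \<open>L\<close>.\<close>

definition inclusion_map ::
    "'a::linorder set set \<Rightarrow> nat \<Rightarrow> ('a set \<Rightarrow> 'k::comm_ring_1) set \<Rightarrow> ('a set \<Rightarrow> 'k) set" where
  "inclusion_map L p X = boundaries L p <#>\<^bsub>cycle_group L p\<^esub> X"

text \<open>The persistent homology groups of a filtration \<open>F\<close> are the images of the maps induced
  by the inclusions \<open>F s \<subseteq> F t\<close> for \<open>s \<le> t\<close>; for \<open>s = t\<close> this is the homology of \<open>F t\<close>.\<close>

definition persistent_homology_group ::
    "(real \<Rightarrow> 'a::linorder set set) \<Rightarrow> nat \<Rightarrow> real \<Rightarrow> real \<Rightarrow> ('a set \<Rightarrow> 'k::comm_ring_1) set monoid" where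
  "persistent_homology_group F p s t =
     (homology_group (F t) p)\<lparr>carrier :=
        inclusion_map (F t) p ` carrier (homology_group (F s) p)\<rparr>"

end

theory Submission
  imports Defs
begin

text \<open>Geometrically, a set \<open>S\<close> of vertices of a tree with diameter \<open>\<delta> > 0\<close> has a center \<open>c\<close>, the common
  midpoint of all pairs of points of \<open>S\<close> at distance \<open>\<delta>\<close>, and a vertex can be added to \<open>S\<close> without
  increasing the diameter if and only if it lies in the ball \<open>B\<close> of radius \<open>\<delta> / 2\<close> about \<open>c\<close>. So \<open>B\<close>
  is itself a simplex of diameter \<open>\<delta>\<close>, and the simplices of diameter \<open>\<delta>\<close> fall into classes
  according to \<open>B\<close>. Within a class the diameter-lexicographic order pairs \<open>S - {w}\<close> with
  \<open>S \<union> {w}\<close>, where \<open>w\<close> is the least vertex of \<open>B\<close> that can be added to \<open>S\<close> or removed from it without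
  leaving the class. For a compatible order this \<open>w\<close> is the vertex \<open>m\<close> of \<open>B\<close> closest to the root
  or, if \<open>m\<close> cannot be removed, the next vertex from \<open>m\<close> towards \<open>c\<close>, which is interior to the ball
  and hence can always be added or removed. The only exception is \<open>B = S = {m, q}\<close> for an edge. So every
  simplex of positive diameter that is not an edge of the tree belongs to an apparent pair of two
  non-edges of the same diameter (\<open>apparent_pair_of_non_edge\<close>, \<open>edge_not_paired\<close>). In the proof, the
  center is replaced by the four-point condition for tree metrics.

  Since an edge has its length as diameter, both differences \<open>Rips\<^sub>u - Rips\<^sub>t\<close> and
  \<open>Rips\<^sub>t - T\<^sub>t\<close> consist of all non-edges with diameter in a set of positive numbers, so they are unions
  of apparent pairs. For every distance function, the apparent pairs form the gradient of a discrete
  Morse function on the full complex (\<open>discrete_gradient_apparent_pairs\<close>), and a difference of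
  complexes that is a union of apparent pairs is collapsed by removing the pairs in decreasing
  order of their values (\<open>collapses_along_apparent_pairs\<close>).

  If all cycles are boundaries after an elementary collapse, then also before it
  (\<open>acyclic_elementary_collapse\<close>), and a forest has no nonzero cycle in positive degree. So for \<open>t > 0\<close>
  the homology of \<open>Rips\<^sub>t\<close> vanishes in positive degrees, for \<open>t \<le> 0\<close> it does because
  \<open>Rips\<^sub>t\<close> has no simplex of positive dimension, and with it the persistent homology vanishes.\<close>


section \<open>The diameter-lexicographic order\<close>

context
  fixes S :: "'a set" and d :: "'a \<Rightarrow> 'a \<Rightarrow> real"
  assumes S: "finite S" "S \<noteq> {}"
begin

lemma diam_image: "diam d S = Max ((\<lambda>(x, y). d x y) ` (S \<times> S))"
  by (auto simp: diam_def intro!: arg_cong[where f = Max])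

lemma diam_le_iff: "diam d S \<le> t \<longleftrightarrow> (\<forall>x\<in>S. \<forall>y\<in>S. d x y \<le> t)"
  using S unfolding diam_image by (subst Max_le_iff) auto

lemma diam_less_iff: "diam d S < t \<longleftrightarrow> (\<forall>x\<in>S. \<forall>y\<in>S. d x y < t)"
  using S unfolding diam_image by (subst Max_less_iff) auto

lemma dist_le_diam: "x \<in> S \<Longrightarrow> y \<in> S \<Longrightarrow> d x y \<le> diam d S"
  using diam_le_iff by blast

lemma diam_attained: obtains x y where "x \<in> S" "y \<in> S" "d x y = diam d S"
proof -
  have "diam d S \<in> (\<lambda>(x, y). d x y) ` (S \<times> S)"
    using S unfolding diam_image by (intro Max_in) auto
  with that show thesis by auto
qed

end

lemma diam_mono:
  assumes "finite T" "S \<noteq> {}" "S \<subseteq> T"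
  shows "diam d S \<le> diam d T"
proof -
  have "finite S" "T \<noteq> {}" using assms finite_subset by auto
  with assms show ?thesis by (subst diam_le_iff) (auto intro: dist_le_diam)
qed

lemma diam_eqI:
  assumes "finite S" "\<And>x y. x \<in> S \<Longrightarrow> y \<in> S \<Longrightarrow> d x y \<le> t" "p \<in> S" "q \<in> S" "d p q = t"
  shows "diam d S = t"
proof -
  have "S \<noteq> {}" using assms(3) by blast
  then show ?thesis
    using assms diam_le_iff[of S d t] dist_le_diam[of S p q d] by (simp add: order_antisym)
qed

lemma diam_lex_less_irrefl: "\<not> diam_lex_less d \<sigma> \<sigma>"
  by (auto simp: diam_lex_less_def lexord_irreflexive)

lemma diam_lex_less_trans:
  assumes "diam_lex_less d \<rho> \<sigma>" "diam_lex_less d \<sigma> \<tau>"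
  shows "diam_lex_less d \<rho> \<tau>"
proof -
  have "trans {(x, y). x < (y :: 'a)}" by (auto intro: transI)
  then show ?thesis
    using assms unfolding diam_lex_less_def by (auto dest: lexord_trans)
qed

lemma diam_lex_less_psubset:
  assumes "finite \<tau>" "\<sigma> \<noteq> {}" "\<sigma> \<subset> \<tau>"
  shows "diam_lex_less d \<sigma> \<tau>"
  using diam_mono[of \<tau> \<sigma> d] psubset_card_mono[of \<tau> \<sigma>] assms
  by (auto simp: diam_lex_less_def)

lemma lexord_insort:
  assumes "x < y" "x \<notin> set xs"
  shows "(insort x xs, insort y xs) \<in> lexord {(a, b). a < (b :: 'a::linorder)}"
  using assms by (induction xs) auto

lemma diam_lex_less_insert:
  assumes "finite \<rho>" "x < y" "x \<notin> \<rho>" "y \<notin> \<rho>" "diam d (insert x \<rho>) \<le> diam d (insert y \<rho>)"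
  shows "diam_lex_less d (insert x \<rho>) (insert y \<rho>)"
  using assms lexord_insort[of x y "sorted_list_of_set \<rho>"]
  by (auto simp: diam_lex_less_def sorted_list_of_set_insert)

lemma facet_iff_insert:
  assumes "finite \<tau>"
  shows "facet \<sigma> \<tau> \<longleftrightarrow> \<sigma> \<noteq> {} \<and> (\<exists>x. x \<notin> \<sigma> \<and> \<tau> = insert x \<sigma>)"
proof
  assume f: "facet \<sigma> \<tau>"
  then have "\<sigma> \<subseteq> \<tau>" "finite \<sigma>" using assms finite_subset by (auto simp: facet_def)
  with f have "card (\<tau> - \<sigma>) = 1" by (simp add: facet_def card_Diff_subset)
  then obtain x where "\<tau> - \<sigma> = {x}" by (rule card_1_singletonE)
  with \<open>\<sigma> \<subseteq> \<tau>\<close> f show "\<sigma> \<noteq> {} \<and> (\<exists>x. x \<notin> \<sigma> \<and> \<tau> = insert x \<sigma>)"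
    by (auto simp: facet_def)
qed (use assms in \<open>auto simp: facet_def\<close>)

text \<open>Among the facets of \<open>\<tau>\<close> of full diameter the one that lacks the smallest vertex is the
  largest, and among the cofacets of \<open>\<sigma>\<close> of the same diameter the one that adds the smallest
  vertex is the smallest. So a vertex \<open>w\<close> that is the least one both for removal and for addition
  gives an apparent pair.\<close>

lemma apparent_pairI:
  assumes "finite V" "\<tau> \<subseteq> V" "\<sigma> \<noteq> {}" "w \<notin> \<sigma>" "\<tau> = insert w \<sigma>" "diam d \<sigma> = diam d \<tau>"
    and rem: "\<And>x. x \<in> \<tau> \<Longrightarrow> diam d (\<tau> - {x}) = diam d \<tau> \<Longrightarrow> w \<le> x"
    and add: "\<And>x. x \<in> V \<Longrightarrow> x \<notin> \<sigma> \<Longrightarrow> diam d (insert x \<sigma>) = diam d \<tau> \<Longrightarrow> w \<le> x"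
  shows "apparent_pair d (full_complex V) \<sigma> \<tau>"
  unfolding apparent_pair_def
proof (intro conjI ballI impI)
  have fin: "finite \<psi>" if "\<psi> \<in> full_complex V" for \<psi>
    using that assms(1) finite_subset by (auto simp: full_complex_def)
  show \<sigma>: "\<sigma> \<in> full_complex V" and \<tau>: "\<tau> \<in> full_complex V"
    using assms by (auto simp: full_complex_def)
  show "facet \<sigma> \<tau>" using facet_iff_insert[OF fin[OF \<tau>]] assms by blast
  show "diam_lex_less d \<rho> \<sigma>" if \<rho>in: "\<rho> \<in> full_complex V" "facet \<rho> \<tau> \<and> \<rho> \<noteq> \<sigma>" for \<rho>
  proof -
    obtain x where x: "x \<notin> \<rho>" "\<tau> = insert x \<rho>" "\<rho> \<noteq> {}"
      using \<rho>in(2) facet_iff_insert[OF fin[OF \<tau>], of \<rho>] by metis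
    then have "x \<noteq> w" using assms(4,5) \<rho>in by (metis insert_ident)
    have \<rho>: "\<rho> = insert w (\<tau> - {x, w})" and \<sigma>': "\<sigma> = insert x (\<tau> - {x, w})"
      using x assms \<open>x \<noteq> w\<close> by auto
    have "diam d \<rho> \<le> diam d \<tau>" using diam_mono[OF fin[OF \<tau>] x(3)] x(2) by blast
    then consider "diam d \<rho> < diam d \<sigma>" | "diam d \<rho> = diam d \<tau>"
      using assms by fastforce
    then show ?thesis
    proof cases
      case 1
      then show ?thesis by (simp add: diam_lex_less_def)
    next
      case 2
      have "\<tau> - {x} = \<rho>" using x by auto
      then have "w < x" using rem[of x] x 2 \<open>x \<noteq> w\<close> by auto
      then have "diam_lex_less d (insert w (\<tau> - {x, w})) (insert x (\<tau> - {x, w}))"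
        using fin[OF \<tau>] 2 assms(6) \<rho> \<sigma>' by (intro diam_lex_less_insert) auto
      with \<rho> \<sigma>' show ?thesis by simp
    qed
  qed
  show "diam_lex_less d \<tau> \<psi>" if \<psi>: "\<psi> \<in> full_complex V" "facet \<sigma> \<psi> \<and> \<psi> \<noteq> \<tau>" for \<psi>
  proof -
    obtain x where x: "x \<notin> \<sigma>" "\<psi> = insert x \<sigma>"
      using \<psi>(2) facet_iff_insert[OF fin[OF \<psi>(1)], of \<sigma>] by metis
    then have "x \<noteq> w" "x \<in> V" using assms \<psi> by (auto simp: full_complex_def)
    have "diam d \<sigma> \<le> diam d \<psi>"
      using diam_mono[OF fin[OF \<psi>(1)] \<open>\<sigma> \<noteq> {}\<close>] x(2) by blast
    then consider "diam d \<tau> < diam d \<psi>" | "diam d \<psi> = diam d \<tau>"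
      using assms by fastforce
    then show ?thesis
    proof cases
      case 1
      then show ?thesis by (simp add: diam_lex_less_def)
    next
      case 2
      then have "w < x" using add[of x] x \<open>x \<in> V\<close> \<open>x \<noteq> w\<close> by auto
      with x 2 show ?thesis
        unfolding \<open>\<tau> = insert w \<sigma>\<close> x(2) using fin[OF \<sigma>] assms(4,5)
        by (intro diam_lex_less_insert) auto
    qed
  qed
qed


section \<open>The apparent pairs gradient\<close>

lemma diam_lex_rank:
  assumes "finite M"
  obtains rk :: "'a::linorder set \<Rightarrow> nat" where
    "\<And>\<sigma> \<tau>. \<sigma> \<in> M \<Longrightarrow> diam_lex_less d \<sigma> \<tau> \<Longrightarrow> rk \<sigma> < rk \<tau>"
proof
  fix \<sigma> \<tau> assume "\<sigma> \<in> M" and less: "diam_lex_less d \<sigma> \<tau>"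
  let ?below = "\<lambda>\<tau>. {\<rho> \<in> M. diam_lex_less d \<rho> \<tau>}"
  have "?below \<sigma> \<subset> ?below \<tau>"
    using \<open>\<sigma> \<in> M\<close> less diam_lex_less_irrefl diam_lex_less_trans by blast
  then show "card (?below \<sigma>) < card (?below \<tau>)" using assms by (intro psubset_card_mono) auto
qed

context
  fixes V :: "'a::linorder set" and d :: "'a \<Rightarrow> 'a \<Rightarrow> real"
  assumes V: "finite V"
begin

private abbreviation "pair \<equiv> apparent_pair d (full_complex V)"

lemma finite_full_complex: "finite (full_complex V)"
  by (rule finite_subset[of _ "Pow V"]) (auto simp: full_complex_def V)

lemma full_complex_finite: "\<sigma> \<in> full_complex V \<Longrightarrow> finite \<sigma>"
  using V finite_subset by (auto simp: full_complex_def)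

lemma apparent_pair_unique:
  assumes "pair \<sigma> \<tau>" "pair \<sigma>' \<tau>'"
  shows "\<sigma> = \<sigma>' \<longleftrightarrow> \<tau> = \<tau>'"
  using assms diam_lex_less_irrefl diam_lex_less_trans unfolding apparent_pair_def by metis

text \<open>If \<open>\<tau>\<close> is the minimal cofacet of \<open>\<sigma>\<close> and the maximal facet of \<open>\<phi>\<close>, then the facet of \<open>\<phi>\<close> that
  contains \<open>\<sigma>\<close> and differs from \<open>\<tau>\<close> is on the one hand larger, on the other hand smaller
  than \<open>\<tau>\<close>.\<close>

lemma apparent_pair_not_chained:
  assumes "pair \<sigma> \<tau>" "pair \<tau> \<phi>"
  shows False
proof -
  have M: "\<sigma> \<in> full_complex V" "\<tau> \<in> full_complex V" "\<phi> \<in> full_complex V" "facet \<sigma> \<tau>" "facet \<tau> \<phi>"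
    using assms by (auto simp: apparent_pair_def)
  obtain x where x: "x \<notin> \<sigma>" "\<tau> = insert x \<sigma>" "\<sigma> \<noteq> {}"
    using M facet_iff_insert full_complex_finite by metis
  obtain y where y: "y \<notin> \<tau>" "\<phi> = insert y \<tau>"
    using M facet_iff_insert full_complex_finite by metis
  define \<psi> where "\<psi> = insert y \<sigma>"
  have \<psi>: "\<psi> \<in> full_complex V" using M x y by (auto simp: \<psi>_def full_complex_def)
  have "\<phi> = insert x \<psi>" "x \<notin> \<psi>" "\<psi> \<noteq> {}" using x y by (auto simp: \<psi>_def)
  then have "facet \<psi> \<phi>" using facet_iff_insert[OF full_complex_finite[OF M(3)]] by blast
  moreover have "facet \<sigma> \<psi>"
    using facet_iff_insert[OF full_complex_finite[OF \<psi>]] x y by (auto simp: \<psi>_def)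
  moreover have "\<psi> \<noteq> \<tau>" using x y by (auto simp: \<psi>_def)
  ultimately have "diam_lex_less d \<psi> \<tau>" "diam_lex_less d \<tau> \<psi>"
    using assms \<psi> unfolding apparent_pair_def by blast+
  then show False using diam_lex_less_irrefl diam_lex_less_trans by blast
qed

definition morse_intervals :: "'a set set set" where
  "morse_intervals = apparent_pairs_gradient d V \<union>
     {{\<psi>} |\<psi>. \<psi> \<in> full_complex V - \<Union> (apparent_pairs_gradient d V)}"

lemma face_interval_facet:
  assumes "facet \<sigma> \<tau>" "\<sigma> \<in> K" "\<tau> \<in> K" "finite \<tau>"
  shows "face_interval K \<sigma> \<tau> = {\<sigma>, \<tau>}"
  using assms facet_iff_insert[OF assms(4), of \<sigma>] by (auto simp: face_interval_def)

lemma interval_partition_morse_intervals: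
  "interval_partition (full_complex V) morse_intervals"
  unfolding interval_partition_def
proof (intro conjI ballI)
  let ?M = "full_complex V" and ?W = "apparent_pairs_gradient d V"
  have W: "I \<in> ?W \<longleftrightarrow> (\<exists>\<sigma> \<tau>. I = {\<sigma>, \<tau>} \<and> pair \<sigma> \<tau>)" for I
    by (auto simp: apparent_pairs_gradient_def)
  have sub: "I \<subseteq> ?M" if "I \<in> ?W" for I
    using that by (auto simp: W apparent_pair_def)
  have disj: "I = J" if "I \<in> ?W" "J \<in> ?W" "I \<inter> J \<noteq> {}" for I J
  proof -
    obtain \<sigma> \<tau> \<sigma>' \<tau>' where p: "I = {\<sigma>, \<tau>}" "J = {\<sigma>', \<tau>'}" "pair \<sigma> \<tau>" "pair \<sigma>' \<tau>'"
      using \<open>I \<in> ?W\<close> \<open>J \<in> ?W\<close> W by metis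
    have "\<sigma> \<noteq> \<tau>'" "\<tau> \<noteq> \<sigma>'" using p apparent_pair_not_chained by blast+
    then show ?thesis using p apparent_pair_unique[OF p(3,4)] that(3) by auto
  qed
  show "partition_on ?M morse_intervals"
  proof (rule partition_onI)
    have "\<Union> {{\<psi>} |\<psi>. \<psi> \<in> A} = A" for A :: "'a set set" by blast
    then show "\<Union> morse_intervals = ?M"
      using sub unfolding morse_intervals_def Union_Un_distrib by blast
    show "disjnt I J" if "I \<in> morse_intervals" "J \<in> morse_intervals" "I \<noteq> J" for I J
      using that disj[of I J] unfolding morse_intervals_def disjnt_def by blast
    show "{} \<notin> morse_intervals" by (auto simp: morse_intervals_def W)
  qed
  fix I assume "I \<in> morse_intervals"
  then consider \<sigma> \<tau> where "I = {\<sigma>, \<tau>}" "pair \<sigma> \<tau>" | \<psi> where "I = {\<psi>}" "\<psi> \<in> ?M"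
    by (auto simp: morse_intervals_def W)
  then show "\<exists>\<rho>\<in>?M. \<exists>\<phi>\<in>?M. \<rho> \<subseteq> \<phi> \<and> I = face_interval ?M \<rho> \<phi>"
  proof cases
    case 1
    then show ?thesis
      using face_interval_facet[of \<sigma> \<tau> ?M] full_complex_finite
      unfolding apparent_pair_def facet_def by metis
  next
    case 2
    then have "I = face_interval ?M \<psi> \<psi>" by (auto simp: face_interval_def)
    with 2 show ?thesis by blast
  qed
qed

text \<open>Number the simplices along the order and let \<open>f\<close> assign to \<open>\<psi>\<close> the number of the upper simplex
  of its interval. If \<open>\<sigma>\<close> is the lower simplex of an apparent pair \<open>(\<sigma>, \<tau>)\<close> and
  \<open>\<sigma> \<subset> \<psi>\<close>, then \<open>\<psi>\<close> contains a cofacet of \<open>\<sigma>\<close>, which by minimality of \<open>\<tau>\<close> does not precede \<open>\<tau>\<close>;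
  so \<open>\<tau>\<close> does not come after \<open>\<psi>\<close> either.\<close>

theorem discrete_gradient_apparent_pairs:
  "discrete_gradient (full_complex V) (apparent_pairs_gradient d V)"
proof -
  let ?M = "full_complex V" and ?W = "apparent_pairs_gradient d V"
  have W: "I \<in> ?W \<longleftrightarrow> (\<exists>\<sigma> \<tau>. I = {\<sigma>, \<tau>} \<and> pair \<sigma> \<tau>)" for I
    by (auto simp: apparent_pairs_gradient_def)
  obtain rk :: "'a set \<Rightarrow> nat"
    where rk: "\<And>\<sigma> \<tau>. \<sigma> \<in> ?M \<Longrightarrow> diam_lex_less d \<sigma> \<tau> \<Longrightarrow> rk \<sigma> < rk \<tau>"
    using diam_lex_rank[OF finite_full_complex] by blast
  define up where "up \<psi> = (if \<exists>\<tau>. pair \<psi> \<tau> then THE \<tau>. pair \<psi> \<tau> else \<psi>)" for \<psi>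
  have up: "up \<sigma> = \<tau>" "up \<tau> = \<tau>" if "pair \<sigma> \<tau>" for \<sigma> \<tau>
  proof -
    have "(THE \<tau>. pair \<sigma> \<tau>) = \<tau>"
      using that apparent_pair_unique[OF that] by (intro the_equality) auto
    with that show "up \<sigma> = \<tau>" by (auto simp: up_def)
    show "up \<tau> = \<tau>" using that apparent_pair_not_chained by (auto simp: up_def)
  qed
  have up_other: "pair \<psi> (up \<psi>) \<or> up \<psi> = \<psi>" for \<psi>
  proof (cases "\<exists>\<tau>. pair \<psi> \<tau>")
    case True
    then obtain \<tau> where "pair \<psi> \<tau>" by blast
    then show ?thesis using up(1) by simp
  qed (simp add: up_def)
  have up_rk: "rk \<psi> \<le> rk (up \<psi>)" "up \<psi> \<in> ?M" if "\<psi> \<in> ?M" for \<psi>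
  proof -
    have "rk \<psi> < rk (up \<psi>)" if "pair \<psi> (up \<psi>)"
    proof (rule rk)
      have "facet \<psi> (up \<psi>)" "up \<psi> \<in> ?M" using that by (auto simp: apparent_pair_def)
      then show "diam_lex_less d \<psi> (up \<psi>)"
        using full_complex_finite by (intro diam_lex_less_psubset) (auto simp: facet_def)
    qed fact
    then show "rk \<psi> \<le> rk (up \<psi>)" using up_other[of \<psi>] by fastforce
    show "up \<psi> \<in> ?M" using up_other[of \<psi>] that by (auto simp: apparent_pair_def)
  qed
  have up_le: "up \<sigma> = \<psi> \<or> rk (up \<sigma>) < rk \<psi>"
    if \<sigma>: "\<sigma> \<in> ?M" and \<psi>: "\<psi> \<in> ?M" and sub: "\<sigma> \<subset> \<psi>" for \<sigma> \<psi>
  proof -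
    have fin: "finite \<psi>" and ne: "\<sigma> \<noteq> {}" using full_complex_finite \<psi> \<sigma> by (auto simp: full_complex_def)
    have less: "diam_lex_less d \<sigma> \<psi>" using diam_lex_less_psubset fin ne sub by blast
    show ?thesis
    proof (cases "pair \<sigma> (up \<sigma>)")
      case True
      obtain x where x: "x \<in> \<psi>" "x \<notin> \<sigma>" using sub by blast
      let ?\<phi> = "insert x \<sigma>"
      have "?\<phi> \<subseteq> \<psi>" "?\<phi> \<in> ?M" using \<sigma> \<psi> sub x by (auto simp: full_complex_def)
      moreover have "facet \<sigma> ?\<phi>"
        using facet_iff_insert[of ?\<phi> \<sigma>] full_complex_finite[OF \<open>?\<phi> \<in> ?M\<close>] x ne by auto
      ultimately have "up \<sigma> = ?\<phi> \<or> rk (up \<sigma>) < rk ?\<phi>"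
        using True rk up_rk(2)[OF \<sigma>] unfolding apparent_pair_def by metis
      moreover have "?\<phi> = \<psi> \<or> rk ?\<phi> < rk \<psi>"
        using diam_lex_less_psubset[OF fin, of ?\<phi>] rk \<open>?\<phi> \<subseteq> \<psi>\<close> \<open>?\<phi> \<in> ?M\<close> by blast
      ultimately show ?thesis by (elim disjE) simp_all
    next
      case False
      with up_other[of \<sigma>] rk[OF \<sigma> less] show ?thesis by simp
    qed
  qed
  have "morse_function_for ?M morse_intervals (\<lambda>\<psi>. real (rk (up \<psi>)))"
    unfolding morse_function_for_def
  proof (intro conjI ballI impI)
    show "interval_partition ?M morse_intervals" by (rule interval_partition_morse_intervals)
    fix \<sigma> \<psi> assume M: "\<sigma> \<in> ?M" "\<psi> \<in> ?M" and "\<sigma> \<subseteq> \<psi>"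
    have le: "up \<sigma> = up \<psi> \<or> rk (up \<sigma>) < rk (up \<psi>)"
    proof (cases "\<sigma> = \<psi> \<or> rk (up \<sigma>) < rk \<psi>")
      case True
      then show ?thesis using up_rk(1)[OF M(2)] by auto
    next
      case False
      then have \<psi>: "up \<sigma> = \<psi>" "\<sigma> \<noteq> \<psi>" using up_le[OF M] \<open>\<sigma> \<subseteq> \<psi>\<close> by auto
      then have "pair \<sigma> \<psi>" using up_other[of \<sigma>] by auto
      then show ?thesis using up by simp
    qed
    then show "real (rk (up \<sigma>)) \<le> real (rk (up \<psi>))" by auto
    have "up \<sigma> = up \<psi> \<longleftrightarrow> (\<exists>I\<in>morse_intervals. \<sigma> \<in> I \<and> \<psi> \<in> I)"
    proof
      assume eq: "up \<sigma> = up \<psi>"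
      show "\<exists>I\<in>morse_intervals. \<sigma> \<in> I \<and> \<psi> \<in> I"
      proof (cases "\<sigma> = \<psi>")
        case True
        then show ?thesis
          using M interval_partition_morse_intervals
          by (auto simp: interval_partition_def partition_on_def)
      next
        case False
        with eq up_other[of \<sigma>] up_other[of \<psi>] apparent_pair_unique
        have "pair \<sigma> \<psi> \<or> pair \<psi> \<sigma>" by metis
        then have "{\<sigma>, \<psi>} \<in> ?W" by (auto simp: W insert_commute)
        then show ?thesis by (auto simp: morse_intervals_def)
      qed
    next
      assume "\<exists>I\<in>morse_intervals. \<sigma> \<in> I \<and> \<psi> \<in> I"
      then have "\<sigma> = \<psi> \<or> (\<exists>I\<in>?W. \<sigma> \<in> I \<and> \<psi> \<in> I)" by (auto simp: morse_intervals_def)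
      then show "up \<sigma> = up \<psi>" using up by (auto simp: W)
    qed
    moreover have "real (rk (up \<sigma>)) = real (rk (up \<psi>)) \<longleftrightarrow> up \<sigma> = up \<psi>"
      using le by (metis less_irrefl of_nat_eq_iff)
    ultimately show "real (rk (up \<sigma>)) = real (rk (up \<psi>)) \<longleftrightarrow>
        (\<exists>I\<in>morse_intervals. \<sigma> \<in> I \<and> \<psi> \<in> I)" by simp
  qed
  moreover have "?W = regular_intervals ?M morse_intervals"
  proof (intro equalityI subsetI)
    fix I assume "I \<in> ?W"
    then obtain \<sigma> \<tau> where I: "I = {\<sigma>, \<tau>}" "pair \<sigma> \<tau>" by (auto simp: W)
    then have M: "\<sigma> \<in> ?M" "\<tau> \<in> ?M" "facet \<sigma> \<tau>" "finite \<tau>"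
      using full_complex_finite by (auto simp: apparent_pair_def)
    moreover have "\<sigma> \<subseteq> \<tau>" "\<sigma> \<noteq> \<tau>" using M(3) by (auto simp: facet_def)
    moreover have "I = face_interval ?M \<sigma> \<tau>"
      using face_interval_facet[of \<sigma> \<tau> ?M] I M by simp
    ultimately show "I \<in> regular_intervals ?M morse_intervals"
      using \<open>I \<in> ?W\<close> unfolding regular_intervals_def morse_intervals_def by blast
  next
    fix I assume "I \<in> regular_intervals ?M morse_intervals"
    then obtain \<rho> \<phi> where "I \<in> morse_intervals" "\<rho> \<in> I" "\<phi> \<in> I" "\<rho> \<noteq> \<phi>"
      by (auto simp: regular_intervals_def face_interval_def)
    then show "I \<in> ?W" by (auto simp: morse_intervals_def)
  qed
  ultimately show ?thesis unfolding discrete_gradient_def by blast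
qed

text \<open>The pairs are removed in decreasing order of their upper simplex: a simplex
  \<open>\<rho> \<supset> \<sigma>\<close> that is still present belongs to a pair that was not removed before, so its value under a
  Morse function is at most that of \<open>\<sigma>\<close>, hence equal, and \<open>\<rho>\<close> is the partner of \<open>\<sigma>\<close>.\<close>

theorem collapses_along_apparent_pairs:
  assumes "K \<subseteq> full_complex V" "W' \<subseteq> apparent_pairs_gradient d V" "K - L = \<Union> W'" "L \<subseteq> K"
    and L: "\<And>\<rho> \<sigma>. \<rho> \<in> L \<Longrightarrow> \<sigma> \<subseteq> \<rho> \<Longrightarrow> \<sigma> \<noteq> {} \<Longrightarrow> \<sigma> \<in> L"
  shows "collapses K L"
proof -
  let ?M = "full_complex V" and ?W = "apparent_pairs_gradient d V"
  obtain P f where f: "morse_function_for ?M P f" "?W = regular_intervals ?M P"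
    using discrete_gradient_apparent_pairs unfolding discrete_gradient_def by blast
  have P: "I \<in> P" if "I \<in> ?W" for I using that f by (simp add: regular_intervals_def)
  have "finite W'"
  proof (rule finite_subset)
    show "W' \<subseteq> Pow ?M"
      using assms(2) by (auto simp: apparent_pairs_gradient_def apparent_pair_def)
  qed (simp add: finite_full_complex)
  then show ?thesis
    using assms(1-4)
  proof (induction "card W'" arbitrary: K W')
    case 0
    then show ?case by (simp add: collapses_def)
  next
    case (Suc n)
    have fin: "finite (K - L)" using Suc.prems finite_full_complex finite_subset by (metis finite_Diff)
    have "K - L \<noteq> {}"
    proof -
      obtain I where "I \<in> W'" using Suc.hyps(2) by fastforce
      moreover from this have "I \<noteq> {}" using Suc.prems by (auto simp: apparent_pairs_gradient_def)
      ultimately show ?thesis using Suc.prems(4) by blast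
    qed
    then have "Max (f ` (K - L)) \<in> f ` (K - L)" using fin by (intro Max_in) auto
    then obtain \<psi> where "\<psi> \<in> K - L" "f \<psi> = Max (f ` (K - L))" by auto
    then have \<psi>: "\<psi> \<in> K - L" "\<forall>\<rho>\<in>K - L. f \<rho> \<le> f \<psi>" using fin by auto
    then obtain I where I: "I \<in> W'" "\<psi> \<in> I" using Suc.prems by auto
    obtain \<sigma> \<tau> where st: "I = {\<sigma>, \<tau>}" "pair \<sigma> \<tau>"
      using I Suc.prems by (auto simp: apparent_pairs_gradient_def)
    have KL: "\<sigma> \<in> K - L" "\<tau> \<in> K - L" using I st Suc.prems by auto
    have M: "\<sigma> \<in> ?M" "\<tau> \<in> ?M" "facet \<sigma> \<tau>" using st by (auto simp: apparent_pair_def)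
    have part: "J = I" if "J \<in> P" "\<sigma> \<in> J" for J
    proof -
      have "I \<in> P" "\<sigma> \<in> I" using P I Suc.prems st by auto
      moreover have "partition_on ?M P"
        using f by (simp add: morse_function_for_def interval_partition_def)
      ultimately show ?thesis using that by (auto simp: partition_on_def disjoint_def)
    qed
    have top: "\<rho> = \<tau>" if \<rho>: "\<rho> \<in> K" "\<sigma> \<subset> \<rho>" for \<rho>
    proof -
      have ne: "\<sigma> \<noteq> {}" using M by (simp add: full_complex_def)
      then have "\<rho> \<in> K - L" using L[of \<rho> \<sigma>] \<rho> KL by auto
      then have "f \<rho> \<le> f \<psi>" using \<psi> by blast
      also have "f \<psi> = f \<sigma>"
      proof -
        have "f \<sigma> = f \<tau>"
          using f M P[of I] I Suc.prems(3) st unfolding morse_function_for_def facet_def by blast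
        then show ?thesis using I st by auto
      qed
      finally have "f \<rho> \<le> f \<sigma>" .
      moreover have "\<rho> \<in> ?M" using \<rho> Suc.prems by blast
      ultimately obtain J where "J \<in> P" "\<sigma> \<in> J" "\<rho> \<in> J"
        using f M \<rho> unfolding morse_function_for_def by (metis order_antisym psubset_imp_subset)
      then show ?thesis using part st \<rho>(2) by auto
    qed
    let ?K = "K - {\<sigma>, \<tau>}"
    have step: "elementary_collapse K ?K"
      unfolding elementary_collapse_def using KL M top by blast
    have diff: "?K - L = \<Union> (W' - {I})"
    proof -
      have "J \<inter> I = {}" if "J \<in> W'" "J \<noteq> I" for J
      proof -
        have "J \<in> P" "I \<in> P" using that I P Suc.prems by auto
        moreover have "disjoint P"
          using f by (simp add: morse_function_for_def interval_partition_def partition_on_def)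
        ultimately show ?thesis using that by (auto simp: disjoint_def)
      qed
      then have "\<Union> (W' - {I}) = \<Union> W' - I" using I by blast
      with Suc.prems(4) st show ?thesis by auto
    qed
    have "L \<subseteq> ?K" using Suc.prems(5) KL by blast
    moreover have "n = card (W' - {I})" using Suc.hyps(2) Suc.prems(1) I by simp
    ultimately have "collapses ?K L"
      using Suc.prems(1-3) by (intro Suc.hyps(1)[OF _ _ _ _ diff]) auto
    with step show ?case unfolding collapses_def by (rule converse_rtranclp_into_rtranclp)
  qed
qed

end


section \<open>Collapses and homology\<close>

lemma boundary_eq_sum:
  assumes "finite M" "{\<tau>. c \<tau> \<noteq> 0} \<subseteq> M"
  shows "boundary c \<sigma> = (\<Sum>\<tau>\<in>M. c \<tau> * incidence \<tau> \<sigma>)"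
  unfolding boundary_def using assms by (intro sum.mono_neutral_left) auto

lemma boundary_linear:
  fixes c c' :: "'a::linorder set \<Rightarrow> 'k::comm_ring_1"
  assumes "finite {\<tau>. c \<tau> \<noteq> 0}" "finite {\<tau>. c' \<tau> \<noteq> 0}"
  shows "boundary (\<lambda>\<tau>. c \<tau> + a * c' \<tau>) = (\<lambda>\<sigma>. boundary c \<sigma> + a * boundary c' \<sigma>)"
proof
  fix \<sigma>
  let ?M = "{\<tau>. c \<tau> \<noteq> 0} \<union> {\<tau>. c' \<tau> \<noteq> 0}"
  have "finite ?M" using assms by simp
  moreover have "{\<tau>. c \<tau> + a * c' \<tau> \<noteq> 0} \<subseteq> ?M" by auto
  ultimately show "boundary (\<lambda>\<tau>. c \<tau> + a * c' \<tau>) \<sigma> = boundary c \<sigma> + a * boundary c' \<sigma>"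
    by (simp add: boundary_eq_sum[of ?M] algebra_simps sum.distrib sum_distrib_left)
qed

lemma incidence_insert:
  assumes "finite \<sigma>" "v \<notin> \<sigma>" "\<sigma> \<noteq> {}"
  shows "incidence (insert v \<sigma>) \<sigma> = (- 1) ^ card {w \<in> \<sigma>. w < v}"
proof -
  have "facet \<sigma> (insert v \<sigma>)" using assms by (auto simp: facet_def)
  moreover have "insert v \<sigma> - \<sigma> = {v}" using assms by auto
  moreover have "{w \<in> insert v \<sigma>. w < v} = {w \<in> \<sigma>. w < v}" by auto
  ultimately show ?thesis by (simp add: incidence_def)
qed

lemma incidence_square:
  "facet \<sigma> \<tau> \<Longrightarrow> incidence \<tau> \<sigma> * incidence \<tau> \<sigma> = (1 :: 'k::comm_ring_1)"
  by (simp add: incidence_def flip: power_add mult_2)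

text \<open>A face \<open>\<rho>\<close> of codimension two, \<open>\<tau> = \<rho> \<union> {a, b}\<close> with \<open>a < b\<close>, lies in the two facets
  \<open>\<rho> \<union> {a}\<close> and \<open>\<rho> \<union> {b}\<close> of \<open>\<tau>\<close>. The two contributions have opposite signs, since \<open>a\<close> is counted
  as a vertex before \<open>b\<close> only when \<open>b\<close> is removed first.\<close>

lemma boundary_incidence:
  assumes "finite \<tau>"
  shows "boundary (incidence \<tau>) = (\<lambda>_. 0 :: 'k::comm_ring_1)"
proof
  fix \<rho>
  let ?inc = "incidence :: 'a set \<Rightarrow> 'a set \<Rightarrow> 'k"
  have sum: "boundary (?inc \<tau>) \<rho> = (\<Sum>\<sigma> | facet \<sigma> \<tau> \<and> facet \<rho> \<sigma>. ?inc \<tau> \<sigma> * ?inc \<sigma> \<rho>)"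
  proof -
    have "boundary (?inc \<tau>) \<rho> = (\<Sum>\<sigma>\<in>Pow \<tau>. ?inc \<tau> \<sigma> * ?inc \<sigma> \<rho>)"
      using assms by (intro boundary_eq_sum) (auto simp: incidence_def facet_def split: if_splits)
    also have "\<dots> = (\<Sum>\<sigma> | facet \<sigma> \<tau> \<and> facet \<rho> \<sigma>. ?inc \<tau> \<sigma> * ?inc \<sigma> \<rho>)"
      using assms by (intro sum.mono_neutral_right) (auto simp: incidence_def facet_def)
    finally show ?thesis .
  qed
  show "boundary (?inc \<tau>) \<rho> = 0"
  proof (cases "\<exists>\<sigma>. facet \<sigma> \<tau> \<and> facet \<rho> \<sigma>")
    case False
    then have "{\<sigma>. facet \<sigma> \<tau> \<and> facet \<rho> \<sigma>} = {}" by auto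
    with sum show ?thesis by simp
  next
    case True
    then have \<rho>: "\<rho> \<noteq> {}" "\<rho> \<subseteq> \<tau>" "card \<tau> = card \<rho> + 2" by (auto simp: facet_def)
    then have "finite \<rho>" using assms finite_subset by blast
    note \<rho> = \<rho> this
    then have "card (\<tau> - \<rho>) = 2" by (simp add: card_Diff_subset)
    then obtain a b where "\<tau> - \<rho> = {a, b}" "a < b"
      by (metis card_2_iff insert_commute linorder_neqE)
    then have ab: "\<tau> = insert a (insert b \<rho>)" "a \<notin> \<rho>" "b \<notin> \<rho>" "a < b" using \<rho> by auto
    have "{\<sigma>. facet \<sigma> \<tau> \<and> facet \<rho> \<sigma>} = {insert a \<rho>, insert b \<rho>}"
    proof
      show "{\<sigma>. facet \<sigma> \<tau> \<and> facet \<rho> \<sigma>} \<subseteq> {insert a \<rho>, insert b \<rho>}"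
      proof
        fix \<sigma> assume "\<sigma> \<in> {\<sigma>. facet \<sigma> \<tau> \<and> facet \<rho> \<sigma>}"
        then have s: "\<rho> \<subseteq> \<sigma>" "\<sigma> \<subseteq> \<tau>" "card \<sigma> = card \<rho> + 1" by (auto simp: facet_def)
        then have "card (\<sigma> - \<rho>) = 1" using \<rho> by (simp add: card_Diff_subset)
        then obtain x where "\<sigma> - \<rho> = {x}" by (rule card_1_singletonE)
        then have "\<sigma> = insert x \<rho>" "x \<in> {a, b}" using s ab by auto
        then show "\<sigma> \<in> {insert a \<rho>, insert b \<rho>}" by auto
      qed
      show "{insert a \<rho>, insert b \<rho>} \<subseteq> {\<sigma>. facet \<sigma> \<tau> \<and> facet \<rho> \<sigma>}"
        using \<rho> ab by (auto simp: facet_def)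
    qed
    moreover have "insert a \<rho> \<noteq> insert b \<rho>" using ab by auto
    ultimately have "boundary (?inc \<tau>) \<rho> =
        ?inc \<tau> (insert a \<rho>) * ?inc (insert a \<rho>) \<rho> + ?inc \<tau> (insert b \<rho>) * ?inc (insert b \<rho>) \<rho>"
      using sum by simp
    moreover have "?inc \<tau> (insert a \<rho>) = - ((- 1) ^ card {w \<in> \<rho>. w < b})"
    proof -
      have "{w \<in> insert a \<rho>. w < b} = insert a {w \<in> \<rho>. w < b}" using ab by auto
      then have "card {w \<in> insert a \<rho>. w < b} = Suc (card {w \<in> \<rho>. w < b})"
        using ab \<rho> by simp
      then show ?thesis
        using incidence_insert[of "insert a \<rho>" b] \<rho> ab less_imp_neq[OF ab(4)]
        by (simp add: insert_commute)
    qed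
    moreover have "?inc \<tau> (insert b \<rho>) = (- 1) ^ card {w \<in> \<rho>. w < a}"
    proof -
      have "{w \<in> insert b \<rho>. w < a} = {w \<in> \<rho>. w < a}" using ab by auto
      then show ?thesis using incidence_insert[of "insert b \<rho>" a] \<rho> ab less_imp_neq[OF ab(4)]
        by simp
    qed
    ultimately show ?thesis using \<rho> ab by (simp add: incidence_insert)
  qed
qed

definition acyclic_in_degree :: "'k::comm_ring_1 itself \<Rightarrow> nat \<Rightarrow> 'a::linorder set set \<Rightarrow> bool" where
  "acyclic_in_degree _ p K \<longleftrightarrow>
     carrier (cycle_group K p :: ('a set \<Rightarrow> 'k) monoid) \<subseteq> boundaries K p"

lemma chain_iff:
  assumes "finite K"
  shows "c \<in> carrier (chain_group K p) \<longleftrightarrow> (\<forall>\<sigma>. c \<sigma> \<noteq> 0 \<longrightarrow> \<sigma> \<in> K \<and> card \<sigma> = p + 1)"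
proof -
  have "finite {\<sigma> \<in> K. card \<sigma> = p + 1}" using assms by simp
  moreover have "{\<sigma>. c \<sigma> \<noteq> 0} \<subseteq> {\<sigma> \<in> K. card \<sigma> = p + 1} \<longleftrightarrow>
      (\<forall>\<sigma>. c \<sigma> \<noteq> 0 \<longrightarrow> \<sigma> \<in> K \<and> card \<sigma> = p + 1)" by blast
  ultimately show ?thesis unfolding chain_group_def using finite_subset[of "{\<sigma>. c \<sigma> \<noteq> 0}"] by auto
qed

lemma cycle_iff:
  "c \<in> carrier (cycle_group K p) \<longleftrightarrow> c \<in> carrier (chain_group K p) \<and> boundary c = (\<lambda>_. 0)"
  by (simp add: cycle_group_def)

lemma chain_group_mono: "K \<subseteq> L \<Longrightarrow> carrier (chain_group K p) \<subseteq> carrier (chain_group L p)"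
  by (auto simp: chain_group_def)

lemma boundaries_mono: "K \<subseteq> L \<Longrightarrow> boundaries K p \<subseteq> boundaries L p"
  unfolding boundaries_def by (intro image_mono chain_group_mono)

lemma finite_support: "c \<in> carrier (chain_group K p) \<Longrightarrow> finite {\<tau>. c \<tau> \<noteq> 0}"
  by (simp add: chain_group_def)

lemma chain_linear:
  assumes "c \<in> carrier (chain_group K p)" "c' \<in> carrier (chain_group K p)"
  shows "(\<lambda>\<tau>. c \<tau> + a * c' \<tau>) \<in> carrier (chain_group K p)"
proof -
  let ?S = "{\<sigma> \<in> K. card \<sigma> = p + 1}"
  have "{\<tau>. c \<tau> + a * c' \<tau> \<noteq> 0} \<subseteq> {\<tau>. c \<tau> \<noteq> 0} \<union> {\<tau>. c' \<tau> \<noteq> 0}" by auto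
  moreover have "{\<tau>. c \<tau> \<noteq> 0} \<subseteq> ?S" "{\<tau>. c' \<tau> \<noteq> 0} \<subseteq> ?S"
    using assms by (simp_all add: chain_group_def)
  ultimately have "{\<tau>. c \<tau> + a * c' \<tau> \<noteq> 0} \<subseteq> ?S" by blast
  moreover have "finite {\<tau>. c \<tau> + a * c' \<tau> \<noteq> 0}"
    using finite_subset[OF \<open>_ \<subseteq> _ \<union> _\<close>] assms[THEN finite_support] by blast
  ultimately show ?thesis by (simp add: chain_group_def)
qed

lemma zero_chain: "(\<lambda>_. 0) \<in> carrier (chain_group K p)"
  by (simp add: chain_group_def)

lemma boundary_zero: "boundary (\<lambda>_. 0) = (\<lambda>_. 0)"
  by (rule ext) (simp add: boundary_def)

lemma boundaries_linear:
  assumes "b \<in> boundaries K p" "b' \<in> boundaries K p"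
  shows "(\<lambda>\<sigma>. b \<sigma> + a * b' \<sigma>) \<in> boundaries K p"
proof -
  obtain c c' where c: "c \<in> carrier (chain_group K (p + 1))" "c' \<in> carrier (chain_group K (p + 1))"
    and b: "b = boundary c" "b' = boundary c'"
    using assms by (auto simp: boundaries_def)
  show ?thesis
    unfolding boundaries_def b
    using boundary_linear[OF c[THEN finite_support], of a] chain_linear[OF c, of a]
    by (intro image_eqI[of _ boundary "\<lambda>\<tau>. c \<tau> + a * c' \<tau>"]) simp_all
qed

lemma zero_boundary: "(\<lambda>_. 0) \<in> boundaries K p"
  unfolding boundaries_def using image_eqI[of _ boundary, OF boundary_zero[symmetric] zero_chain] .

lemma simplicial_complexD:
  assumes "simplicial_complex K" "\<sigma> \<in> K"
  shows "finite \<sigma>" "\<sigma> \<noteq> {}" "\<rho> \<noteq> {} \<Longrightarrow> \<rho> \<subseteq> \<sigma> \<Longrightarrow> \<rho> \<in> K"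
  using assms unfolding simplicial_complex_def by blast+

lemma elementary_collapse_complex:
  assumes "simplicial_complex K" "elementary_collapse K L"
  shows "simplicial_complex L"
proof -
  obtain \<sigma> \<tau> where st: "\<sigma> \<in> K" "\<tau> \<in> K" "facet \<sigma> \<tau>" "\<forall>\<rho>\<in>K. \<sigma> \<subset> \<rho> \<longrightarrow> \<rho> = \<tau>" "L = K - {\<sigma>, \<tau>}"
    using assms(2) by (auto simp: elementary_collapse_def)
  have lt: "\<sigma> \<subset> \<tau>" using st(3) by (auto simp: facet_def)
  show ?thesis
    unfolding simplicial_complex_def
  proof (intro ballI conjI allI impI)
    fix \<psi> assume "\<psi> \<in> L"
    then have \<psi>: "\<psi> \<in> K" "\<psi> \<noteq> \<sigma>" "\<psi> \<noteq> \<tau>" using st by auto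
    then show "finite \<psi>" "\<psi> \<noteq> {}" using assms(1) simplicial_complexD by blast+
    fix \<rho> assume \<rho>: "\<rho> \<noteq> {} \<and> \<rho> \<subseteq> \<psi>"
    then have "\<rho> \<in> K" using simplicial_complexD(3) assms(1) \<psi>(1) by blast
    moreover have "\<not> \<sigma> \<subseteq> \<psi>" using st(4) \<psi> by blast
    then have "\<rho> \<noteq> \<sigma>" "\<rho> \<noteq> \<tau>" using \<rho> lt by blast+
    ultimately show "\<rho> \<in> L" using st by simp
  qed
qed

text \<open>Let \<open>z\<close> be a cycle of \<open>K\<close> and let \<open>(\<sigma>, \<tau>)\<close> be the removed pair. If \<open>z\<close> has the dimension of \<open>\<tau>\<close>,
  then the coefficient of its boundary at \<open>\<sigma>\<close> comes from \<open>\<tau>\<close> alone, so \<open>\<tau>\<close> is not in the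
  support of \<open>z\<close>. If \<open>z\<close> has the dimension of \<open>\<sigma>\<close>, then a multiple of the boundary of \<open>\<tau>\<close>
  cancels \<open>\<sigma>\<close>. So \<open>z\<close> is homologous to a cycle of \<open>L\<close>.\<close>

lemma acyclic_elementary_collapse:
  assumes "finite K" "simplicial_complex K" "elementary_collapse K L"
    and L: "acyclic_in_degree TYPE('k::comm_ring_1) p L"
  shows "acyclic_in_degree TYPE('k) p K"
  unfolding acyclic_in_degree_def
proof
  fix z :: "'a set \<Rightarrow> 'k" assume "z \<in> carrier (cycle_group K p)"
  then have z: "z \<in> carrier (chain_group K p)" "boundary z = (\<lambda>_. 0)" by (auto simp: cycle_iff)
  obtain \<sigma> \<tau> where st: "\<sigma> \<in> K" "\<tau> \<in> K" "facet \<sigma> \<tau>" "\<forall>\<rho>\<in>K. \<sigma> \<subset> \<rho> \<longrightarrow> \<rho> = \<tau>" "L = K - {\<sigma>, \<tau>}"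
    using assms(3) by (auto simp: elementary_collapse_def)
  have fin: "finite \<tau>" "finite L" and card: "card \<tau> = card \<sigma> + 1"
    using assms(1) simplicial_complexD(1)[OF assms(2) st(2)] st(3,5) by (simp_all add: facet_def)
  have "L \<subseteq> K" using st by auto
  have L_bdry: "c \<in> boundaries K p"
    if "c \<in> carrier (chain_group K p)" "boundary c = (\<lambda>_. 0)" "c \<sigma> = 0" "c \<tau> = 0" for c :: "'a set \<Rightarrow> 'k"
  proof -
    have "\<forall>\<rho>. c \<rho> \<noteq> 0 \<longrightarrow> \<rho> \<in> K \<and> card \<rho> = p + 1"
      using that(1) by (simp add: chain_iff[OF assms(1)])
    then have "\<forall>\<rho>. c \<rho> \<noteq> 0 \<longrightarrow> \<rho> \<in> L \<and> card \<rho> = p + 1"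
      using that(3,4) unfolding st(5) by (metis Diff_iff empty_iff insert_iff)
    then have "c \<in> carrier (cycle_group L p)"
      using that(2) by (simp add: cycle_iff chain_iff[OF fin(2)])
    then show ?thesis using L boundaries_mono[OF \<open>L \<subseteq> K\<close>] by (auto simp: acyclic_in_degree_def)
  qed
  (* incidences are their own inverses, so this multiple of the boundary of \<tau> cancels \<sigma> *)
  define a where "a = z \<sigma> * incidence \<tau> \<sigma>"
  define z' where "z' = (\<lambda>\<rho>. z \<rho> + (- a) * incidence \<tau> \<rho>)"
  show "z \<in> boundaries K p"
  proof (cases "card \<sigma> = p + 1")
    case True
    have inc: "incidence \<tau> \<in> carrier (chain_group K p :: ('a set \<Rightarrow> 'k) monoid)"
      using simplicial_complexD(3)[OF assms(2) st(2)] True card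
      by (simp add: chain_iff[OF assms(1)] incidence_def facet_def)
    have "z' \<in> carrier (chain_group K p)"
      unfolding z'_def using z inc by (intro chain_linear)
    moreover have "boundary z' = (\<lambda>_. 0)"
      unfolding z'_def using z inc finite_support
      by (subst boundary_linear) (auto simp: boundary_incidence fin)
    moreover have "z' \<sigma> = 0"
      using incidence_square[OF st(3), where ?'k = 'k] by (simp add: z'_def a_def mult.assoc)
    moreover have "z' \<tau> = 0"
    proof -
      have "z \<tau> = 0" using z(1) card True by (auto simp: chain_iff[OF assms(1)])
      then show ?thesis by (simp add: z'_def incidence_def facet_def)
    qed
    ultimately have z'_bdry: "z' \<in> boundaries K p" by (rule L_bdry)
    have "(incidence \<tau> :: 'a set \<Rightarrow> 'k) \<in> boundaries K p"
    proof -
      let ?e = "\<lambda>\<rho>. if \<rho> = \<tau> then 1 else 0 :: 'k"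
      have e: "?e \<in> carrier (chain_group K (p + 1))" using st True card by (auto simp: chain_iff[OF assms(1)])
      have "boundary ?e = incidence \<tau>"
        by (rule ext) (simp add: boundary_eq_sum[of "{\<tau>}"])
      from image_eqI[of _ boundary, OF this[symmetric] e] show ?thesis
        unfolding boundaries_def .
    qed
    from boundaries_linear[OF z'_bdry this, of a] show ?thesis by (simp add: z'_def)
  next
    case False
    then have "z \<sigma> = 0" using z(1) by (auto simp: chain_iff[OF assms(1)])
    moreover have "z \<tau> = 0"
    proof -
      have "boundary z \<sigma> = (\<Sum>\<rho>\<in>K. z \<rho> * incidence \<rho> \<sigma>)"
        using z assms(1) by (intro boundary_eq_sum) (auto simp: chain_iff[OF assms(1)])
      also have "\<dots> = (\<Sum>\<rho>\<in>{\<tau>}. z \<rho> * incidence \<rho> \<sigma>)"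
      proof (rule sum.mono_neutral_right)
        have "\<not> facet \<sigma> \<rho>" if "\<rho> \<in> K - {\<tau>}" for \<rho>
          using st(4) that by (auto simp: facet_def)
        then show "\<forall>\<rho>\<in>K - {\<tau>}. z \<rho> * incidence \<rho> \<sigma> = 0" by (simp add: incidence_def)
      qed (use assms(1) st in auto)
      finally have "z \<tau> * incidence \<tau> \<sigma> * incidence \<tau> \<sigma> = 0" using z(2) by simp
      then show ?thesis using incidence_square[OF st(3), where ?'k = 'k] by (simp add: mult.assoc)
    qed
    ultimately show ?thesis using L_bdry z by blast
  qed
qed

lemma acyclic_collapses:
  assumes "collapses K L" "finite K" "simplicial_complex K"
    and "acyclic_in_degree TYPE('k::comm_ring_1) p L"
  shows "acyclic_in_degree TYPE('k) p K"
  using assms unfolding collapses_def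
proof (induction rule: converse_rtranclp_induct)
  case (step K K')
  have "finite K'" using step by (auto simp: elementary_collapse_def)
  with step show ?case
    using acyclic_elementary_collapse elementary_collapse_complex by blast
qed

text \<open>If every cycle of \<open>F s\<close> bounds in \<open>F s\<close>, then the homology of \<open>F s\<close> has the group of boundaries
  as its only element, and this is mapped to the neutral element of the homology of \<open>F t\<close>.\<close>

lemma trivial_persistent_homology:
  assumes "F s \<subseteq> F t" "acyclic_in_degree TYPE('k::comm_ring_1) p (F s)"
  shows "trivial_group (persistent_homology_group F p s t :: ('a::linorder set \<Rightarrow> 'k) set monoid)"
proof -
  let ?B = "\<lambda>r. boundaries (F r) p :: ('a set \<Rightarrow> 'k) set"
  let ?H = "persistent_homology_group F p s t :: ('a set \<Rightarrow> 'k) set monoid"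
  have mult: "x \<otimes>\<^bsub>cycle_group K p\<^esub> y = (\<lambda>\<sigma>. x \<sigma> + y \<sigma>)" for K and x y :: "'a set \<Rightarrow> 'k"
    by (simp add: cycle_group_def chain_group_def)
  have add: "(\<lambda>\<sigma>. x \<sigma> + y \<sigma>) \<in> ?B r" if "x \<in> ?B r" "y \<in> ?B r" for x y r
    using boundaries_linear[OF that, of 1] by simp
  have diff: "(\<lambda>\<sigma>. x \<sigma> - y \<sigma>) \<in> ?B r" if "x \<in> ?B r" "y \<in> ?B r" for x y r
    using boundaries_linear[OF that, of "- 1"] by simp
  have coset: "?B s #>\<^bsub>cycle_group (F s) p\<^esub> z = ?B s" if "z \<in> carrier (cycle_group (F s) p)" for z
  proof -
    have "z \<in> ?B s" using that assms(2) by (auto simp: acyclic_in_degree_def)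
    then have "x \<in> (\<lambda>b \<sigma>. b \<sigma> + z \<sigma>) ` ?B s" if "x \<in> ?B s" for x
      using diff[OF that, of z] by (intro image_eqI[of _ _ "\<lambda>\<sigma>. x \<sigma> - z \<sigma>"]) auto
    with \<open>z \<in> ?B s\<close> add show ?thesis by (auto simp: r_coset_def mult image_iff)
  qed
  have "(\<lambda>_. 0) \<in> carrier (cycle_group (F s) p :: ('a set \<Rightarrow> 'k) monoid)"
    by (simp add: cycle_iff zero_chain boundary_zero)
  with coset have "carrier (homology_group (F s) p) = {?B s}"
    unfolding homology_group_def FactGroup_def RCOSETS_def by auto
  moreover have prod: "?B t <#>\<^bsub>cycle_group (F t) p\<^esub> ?B r = ?B t" if "F r \<subseteq> F t" for r
  proof -
    have "?B r \<subseteq> ?B t" using boundaries_mono that by blast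
    moreover have "x \<in> ?B t <#>\<^bsub>cycle_group (F t) p\<^esub> ?B r" if "x \<in> ?B t" for x
      using that zero_boundary by (force simp: set_mult_def mult)
    ultimately show ?thesis using add by (auto simp: set_mult_def mult)
  qed
  ultimately have carrier: "carrier ?H = {?B t}"
    using assms(1) by (simp add: persistent_homology_group_def inclusion_map_def)
  moreover have one: "\<one>\<^bsub>?H\<^esub> = ?B t"
    by (simp add: persistent_homology_group_def homology_group_def FactGroup_def)
  moreover have "?B t \<otimes>\<^bsub>?H\<^esub> ?B t = ?B t"
    using prod[of t] by (simp add: persistent_homology_group_def homology_group_def FactGroup_def)
  ultimately have "group ?H" by (intro groupI) auto
  with carrier one show ?thesis by (simp add: trivial_group_def)
qed


section \<open>Betweenness in trees\<close>

lemma path_rev: "path V E x xs y \<Longrightarrow> path V E y (rev xs) x"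
  by (auto simp: path_def successively_rev hd_rev last_rev insert_commute)

lemma path_split:
  assumes "path V E x (as @ z # bs) y"
  shows "path V E x (as @ [z]) z" "path V E z (z # bs) y"
  using assms by (auto simp: path_def successively_append_iff hd_append)

lemma path_join:
  assumes "path V E x (as @ [z]) z" "path V E z (z # bs) y" "set as \<inter> set bs = {}"
  shows "path V E x (as @ z # bs) y"
  using assms by (auto simp: path_def successively_append_iff hd_append)

lemma walk_contains_path:
  assumes "xs \<noteq> []" "set xs \<subseteq> V" "successively (\<lambda>u v. {u, v} \<in> E) xs"
  shows "\<exists>ys. path V E (hd xs) ys (last xs) \<and> set ys \<subseteq> set xs"
  using assms
proof (induction xs)
  case Nil
  then show ?case by simp
next
  case (Cons x xs)
  show ?case
  proof (cases "xs = []")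
    case True
    with Cons.prems have "path V E x [x] x" by (auto simp: path_def)
    with True show ?thesis by force
  next
    case False
    with Cons obtain ys where ys: "path V E (hd xs) ys (last xs)" "set ys \<subseteq> set xs"
      by (auto simp: successively_Cons)
    show ?thesis
    proof (cases "x \<in> set ys")
      case True
      then obtain as bs where "ys = as @ x # bs" by (meson split_list)
      with ys path_split(2)[of V E "hd xs" as x bs "last xs"] False show ?thesis by force
    next
      case x: False
      have "path V E x (x # ys) (last xs)"
        using ys x False Cons.prems by (auto simp: path_def successively_Cons)
      with ys False show ?thesis by force
    qed
  qed
qed

lemma path_concat:
  assumes "path V E x xs y" "path V E y ys z"
  obtains zs where "path V E x zs z" "set zs \<subseteq> set xs \<union> set ys"
proof -
  obtain ys' where ys: "ys = y # ys'" using assms(2) by (cases ys) (auto simp: path_def)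
  have "successively (\<lambda>u v. {u, v} \<in> E) (xs @ ys')"
    using assms ys by (cases ys') (auto simp: path_def successively_append_iff)
  moreover have "hd (xs @ ys') = x" "last (xs @ ys') = z" "xs @ ys' \<noteq> []" "set (xs @ ys') \<subseteq> V"
    using assms ys by (auto simp: path_def)
  ultimately obtain zs where "path V E x zs z" "set zs \<subseteq> set (xs @ ys')"
    using walk_contains_path[of "xs @ ys'" V E] by auto
  with that ys show thesis by auto
qed

locale tree =
  fixes V :: "'a set" and E :: "'a set set"
  assumes tree: "finite_tree V E"
begin

lemma finite_V: "finite V"
  using tree by (simp add: finite_tree_def)

lemma edge_subset: "e \<in> E \<Longrightarrow> e \<subseteq> V"
  using tree by (auto simp: finite_tree_def)

lemma card_edge: "e \<in> E \<Longrightarrow> card e = 2"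
  using tree by (auto simp: finite_tree_def)

lemma edge_vertices:
  assumes "{u, v} \<in> E"
  shows "u \<in> V" "v \<in> V" "u \<noteq> v"
  using edge_subset[OF assms] card_edge[OF assms] by (auto simp: card_2_iff)

lemma path_exists: "x \<in> V \<Longrightarrow> y \<in> V \<Longrightarrow> \<exists>xs. path V E x xs y"
  using tree by (simp add: finite_tree_def)

lemma path_endpoints: "path V E x xs y \<Longrightarrow> x \<in> V \<and> y \<in> V \<and> x \<in> set xs \<and> y \<in> set xs"
  using hd_in_set last_in_set by (fastforce simp: path_def)

text \<open>If two paths part at \<open>x\<close> towards different neighbours, then following the first one to the
  common end and the second one back gives a walk between these neighbours that avoids \<open>x\<close>;
  a path inside this walk closes up to a cycle through \<open>x\<close>.\<close>

lemma path_unique: "path V E x xs y \<Longrightarrow> path V E x ys y \<Longrightarrow> xs = ys"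
proof (induction xs arbitrary: x ys)
  case Nil
  then show ?case by (simp add: path_def)
next
  case (Cons x' xs)
  then have [simp]: "x' = x" by (simp add: path_def)
  obtain ys' where ys: "ys = x # ys'" using Cons.prems by (cases ys) (auto simp: path_def)
  show ?case
  proof (cases "xs = [] \<or> ys' = []")
    case True
    with Cons.prems ys show ?thesis by (auto simp: path_def split: if_splits)
  next
    case False
    then obtain a as b bs where ab: "xs = a # as" "ys' = b # bs" by (meson neq_Nil_conv)
    have a: "path V E a xs y" and b: "path V E b ys' y"
      using path_split(2)[of V E x "[x]" a as y] path_split(2)[of V E x "[x]" b bs y]
        Cons.prems ys ab by auto
    have "a = b"
    proof (rule ccontr)
      assume "a \<noteq> b"
      obtain zs where zs: "path V E a zs b" "set zs \<subseteq> set xs \<union> set ys'"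
        using path_concat[OF a path_rev[OF b]] by auto
      have "x \<notin> set zs" "{x, a} \<in> E" "{x, b} \<in> E"
        using zs(2) Cons.prems ys ab by (auto simp: path_def)
      moreover have "2 \<le> length zs"
        using zs(1) \<open>a \<noteq> b\<close> by (cases zs; cases "tl zs") (auto simp: path_def)
      ultimately have "cycle E (x # zs)"
        using zs(1) by (auto simp: cycle_def path_def successively_Cons insert_commute)
      then show False using tree by (auto simp: finite_tree_def)
    qed
    with Cons.IH[OF a] b ys show ?thesis by simp
  qed
qed

text \<open>The vertices between \<open>x\<close> and \<open>y\<close>. They are described as the vertices below \<open>y\<close> for the root
  \<open>x\<close>, so that compatibility of a vertex order is a statement about betweenness.\<close>

definition seg :: "'a \<Rightarrow> 'a \<Rightarrow> 'a set" where
  "seg x y = {z. root_le V E x z y}"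

lemma seg_eq: "path V E x xs y \<Longrightarrow> seg x y = set xs"
  using path_unique by (auto simp: seg_def root_le_def)

lemma seg_vertices: "z \<in> seg x y \<Longrightarrow> x \<in> V \<and> y \<in> V \<and> z \<in> V"
  using path_endpoints by (fastforce simp: seg_def root_le_def path_def)

lemma seg_commute: "seg x y = seg y x"
  unfolding seg_def root_le_def by (metis path_rev set_rev)

lemma seg_split:
  assumes "z \<in> seg x y"
  obtains as bs where "path V E x (as @ z # bs) y"
  using assms by (metis mem_Collect_eq root_le_def seg_def split_list)

lemma seg_mono:
  assumes "z \<in> seg x y"
  shows "seg z y \<subseteq> seg x y"
proof -
  obtain as bs where *: "path V E x (as @ z # bs) y" using assms by (rule seg_split)
  show ?thesis using seg_eq[OF *] seg_eq[OF path_split(2)[OF *]] by auto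
qed

lemma path_edge: "{x, y} \<in> E \<Longrightarrow> path V E x [x, y] y"
  using edge_vertices by (auto simp: path_def)

text \<open>The walk from \<open>x\<close> to \<open>y\<close> through \<open>w\<close> contains the path from \<open>x\<close> to \<open>y\<close>.\<close>

lemma seg_cover:
  assumes "w \<in> V"
  shows "seg x y \<subseteq> seg x w \<union> seg w y"
proof
  fix z assume "z \<in> seg x y"
  then have "x \<in> V" "y \<in> V" using seg_vertices by auto
  then obtain xs ys where *: "path V E x xs w" "path V E w ys y"
    using assms path_exists by meson
  obtain zs where "path V E x zs y" "set zs \<subseteq> set xs \<union> set ys"
    using path_concat[OF *] .
  with * \<open>z \<in> seg x y\<close> show "z \<in> seg x w \<union> seg w y"
    using seg_eq by blast
qed

text \<open>A path from \<open>v\<close> that misses \<open>u\<close> extends by the edge to a path from \<open>u\<close>.\<close>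

lemma edge_orientation:
  assumes "{u, v} \<in> E" "x \<in> V"
  shows "v \<in> seg u x \<or> u \<in> seg v x"
proof -
  obtain xs where xs: "path V E v xs x" using path_exists edge_vertices assms by meson
  show ?thesis
  proof (cases "u \<in> set xs")
    case True
    with seg_eq[OF xs] show ?thesis by simp
  next
    case False
    with xs assms edge_vertices[OF assms(1)] have "path V E u (u # xs) x"
      by (auto simp: path_def successively_Cons)
    from seg_eq[OF this] path_endpoints[OF xs] show ?thesis by auto
  qed
qed

text \<open>The first vertex on the way from \<open>y\<close> to \<open>x\<close> that lies on the path between \<open>w\<close> and \<open>x\<close>
  is a median.\<close>

lemma median_exists:
  assumes "x \<in> V" "y \<in> V" "w \<in> V"
  obtains z where "z \<in> seg x y" "z \<in> seg x w" "z \<in> seg y w"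
proof -
  obtain ys ws where ys: "path V E y ys x" and ws: "path V E w ws x"
    using assms path_exists by meson
  have "\<exists>z\<in>set ys. z \<in> set ws" using ys ws path_endpoints by meson
  then obtain as z bs where z: "ys = as @ z # bs" "z \<in> set ws" "\<forall>a\<in>set as. a \<notin> set ws"
    using split_list_first_prop[of ys "\<lambda>a. a \<in> set ws"] by blast
  obtain cs ds where c: "ws = cs @ z # ds" using z(2) by (meson split_list)
  have "path V E z (rev (cs @ [z])) w" using path_rev path_split(1) ws c by metis
  then have "path V E z (z # rev cs) w" by simp
  moreover have "path V E y (as @ [z]) z" using path_split(1) ys z by metis
  ultimately have "path V E y (as @ z # rev cs) w"
    using path_join[of V E y as z "rev cs" w] z(3) c by auto
  then have "z \<in> seg y w" using seg_eq by fastforce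
  moreover have "z \<in> seg x y" "z \<in> seg x w"
    using seg_eq[OF path_rev[OF ys]] seg_eq[OF path_rev[OF ws]] z by auto
  ultimately show thesis by (intro that)
qed

end


section \<open>Tree metrics\<close>

lemma path_weight_simps [simp]:
  "path_weight l [x] = 0"
  "path_weight l (x # y # xs) = l {x, y} + path_weight l (y # xs)"
  by (simp_all add: path_weight_def)

lemma path_weight_append:
  "path_weight l (as @ z # bs) = path_weight l (as @ [z]) + path_weight l (z # bs)"
proof (induction as)
  case (Cons a as)
  then show ?case by (cases as) auto
qed simp

lemma path_weight_rev: "path_weight l (rev xs) = path_weight l xs"
proof (induction xs)
  case (Cons x xs)
  then show ?case
    by (cases xs) (auto simp: path_weight_append[of l _ _ "[x]"] insert_commute)
qed simp

locale weighted_tree = tree V E for V :: "'a set" and E +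
  fixes l :: "'a set \<Rightarrow> real"
  assumes weight_pos: "e \<in> E \<Longrightarrow> 0 < l e"
begin

abbreviation d :: "'a \<Rightarrow> 'a \<Rightarrow> real" where
  "d \<equiv> tree_dist V E l"

lemma dist_path:
  assumes "path V E x xs y"
  shows "d x y = path_weight l xs"
proof -
  have "{xs. path V E x xs y} = {xs}" using assms path_unique by blast
  then show ?thesis by (simp add: tree_dist_def)
qed

lemma dist_edge: "{x, y} \<in> E \<Longrightarrow> d x y = l {x, y}"
  using dist_path[OF path_edge] by simp

lemma dist_commute: "x \<in> V \<Longrightarrow> y \<in> V \<Longrightarrow> d x y = d y x"
  by (metis dist_path path_exists path_rev path_weight_rev)

lemma dist_additive:
  assumes "z \<in> seg x y"
  shows "d x y = d x z + d z y"
proof -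
  obtain as bs where *: "path V E x (as @ z # bs) y" using assms by (rule seg_split)
  show ?thesis
    using dist_path[OF *] dist_path[OF path_split(1)[OF *]] dist_path[OF path_split(2)[OF *]]
      path_weight_append by metis
qed

lemma path_weight_pos:
  assumes "successively (\<lambda>u v. {u, v} \<in> E) (x # xs)" "xs \<noteq> []"
  shows "0 < path_weight l (x # xs)"
  using assms
proof (induction xs arbitrary: x)
  case (Cons y ys)
  then show ?case by (cases "ys = []") (auto simp: weight_pos add_pos_pos)
qed simp

lemma dist_self: "x \<in> V \<Longrightarrow> d x x = 0"
  using dist_path[of x "[x]" x] by (simp add: path_def)

lemma dist_pos:
  assumes "x \<in> V" "y \<in> V" "x \<noteq> y"
  shows "0 < d x y"
proof -
  obtain xs where xs: "path V E x xs y" using path_exists assms by meson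
  then obtain ys where "xs = x # ys" "ys \<noteq> []"
    using assms(3) that by (cases xs) (auto simp: path_def split: if_splits)
  with path_weight_pos[of x ys] dist_path[OF xs] xs show ?thesis by (simp add: path_def)
qed

lemma dist_nonneg: "x \<in> V \<Longrightarrow> y \<in> V \<Longrightarrow> 0 \<le> d x y"
  using dist_pos dist_self by (cases "x = y") force+

lemma dist_triangle:
  assumes "x \<in> V" "y \<in> V" "z \<in> V"
  shows "d x y \<le> d x z + d z y"
proof -
  obtain w where w: "w \<in> seg x y" "w \<in> seg x z" "w \<in> seg y z"
    using median_exists assms by metis
  then have "w \<in> V" using seg_vertices by blast
  have "w \<in> seg z y" using w seg_commute[of z y] by simp
  note w[THEN dist_additive] this[THEN dist_additive]
  moreover have "0 \<le> d w z" "0 \<le> d z w" using dist_nonneg \<open>w \<in> V\<close> assms by auto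
  ultimately show ?thesis by linarith
qed

text \<open>Let \<open>z\<close> be the median of \<open>p\<close>, \<open>q\<close> and \<open>x\<close>. As \<open>z\<close> lies between \<open>p\<close> and \<open>q\<close>, it also lies
  between \<open>y\<close> and one of them, say \<open>p\<close>; then \<open>d x q + d y p\<close> is the sum of the distances from
  \<open>z\<close> to all four points.\<close>

lemma four_point:
  assumes "x \<in> V" "y \<in> V" "p \<in> V" "q \<in> V"
  shows "d x y + d p q \<le> max (d x p + d y q) (d x q + d y p)"
proof -
  obtain z where z: "z \<in> seg p q" "z \<in> seg p x" "z \<in> seg q x"
    using median_exists assms by metis
  then have V: "z \<in> V" using seg_vertices by blast
  have *: "d p q = d p z + d z q" "d x p = d x z + d z p" "d x q = d x z + d z q"
    using z seg_commute[of x] by (auto intro: dist_additive)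
  have tri: "d x y \<le> d x z + d z y" using dist_triangle assms V by blast
  consider "z \<in> seg p y" | "z \<in> seg y q" using seg_cover[OF assms(2)] z(1) by blast
  then show ?thesis
  proof cases
    case 1
    then have "d y p = d y z + d z p" by (subst dist_additive[of z]) (simp_all add: seg_commute)
    then have "d x y + d p q \<le> d x q + d y p"
      using * tri dist_commute[of z p] dist_commute[of z y] V assms by simp
    then show ?thesis by simp
  next
    case 2
    then have "d y q = d y z + d z q" by (rule dist_additive)
    then have "d x y + d p q \<le> d x p + d y q"
      using * tri dist_commute[of z p] dist_commute[of z y] V assms by simp
    then show ?thesis by simp
  qed
qed

text \<open>The distance to a fixed vertex is a convex function along paths, and it takes its maximum over a
  path only at the ends.\<close>

lemma dist_convex:
  assumes "z \<in> seg x y" "w \<in> V"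
  shows "d z w \<le> max (d x w) (d y w)"
    and "z \<noteq> x \<Longrightarrow> z \<noteq> y \<Longrightarrow> d z w < max (d x w) (d y w)"
proof -
  have V: "x \<in> V" "y \<in> V" "z \<in> V" using seg_vertices assms(1) by blast+
  have "d z x = d x z" "d w x = d x w" "d w y = d y w" using dist_commute V assms(2) by auto
  then have "d z w + d x y \<le> d x z + d y w \<or> d z w + d x y \<le> d z y + d x w"
    using four_point[of z w x y] V assms by (simp add: le_max_iff_disj)
  moreover have "d x y = d x z + d z y" using dist_additive assms by blast
  ultimately have *: "d z w \<le> d y w - d z y \<or> d z w \<le> d x w - d x z" by linarith
  show "d z w \<le> max (d x w) (d y w)"
    using * dist_nonneg[of x z] dist_nonneg[of z y] V by linarith
  assume "z \<noteq> x" "z \<noteq> y"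
  then have "0 < d x z" "0 < d z y" using dist_pos V by blast+
  with * show "d z w < max (d x w) (d y w)" by linarith
qed

text \<open>If \<open>u \<noteq> v\<close>, then each of \<open>u\<close> and \<open>v\<close>, being on the path from \<open>w\<close> to \<open>x\<close> and not on the
  edge from \<open>w\<close> to the other one, lies between the other one and \<open>x\<close>; this is impossible for positive distances.\<close>

lemma parent_unique:
  assumes "{w, u} \<in> E" "{w, v} \<in> E" "u \<in> seg w x" "v \<in> seg w x"
  shows "u = v"
proof (rule ccontr)
  assume "u \<noteq> v"
  have V: "u \<in> V" "v \<in> V" "u \<noteq> w" "v \<noteq> w" using edge_vertices assms by blast+
  have "u \<in> seg v x"
    using seg_cover[OF V(2), of w x] assms V \<open>u \<noteq> v\<close> seg_eq[OF path_edge[OF assms(2)]] by auto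
  moreover have "v \<in> seg u x"
    using seg_cover[OF V(1), of w x] assms V \<open>u \<noteq> v\<close> seg_eq[OF path_edge[OF assms(1)]] by auto
  ultimately have "d v x = d v u + d u x" "d u x = d u v + d v x"
    using dist_additive by blast+
  moreover have "0 < d u v" "0 < d v u" using dist_pos V \<open>u \<noteq> v\<close> by auto
  ultimately show False by linarith
qed

end


section \<open>Apparent pairs of a tree metric\<close>

locale ordered_weighted_tree = weighted_tree V E l
  for V :: "'a::linorder set" and E :: "'a set set" and l :: "'a set \<Rightarrow> real" +
  assumes compatible: "compatible_order V E"
begin

lemma finite_simplex: "S \<subseteq> V \<Longrightarrow> finite S"
  using finite_V finite_subset by blast

lemma diam_edge:
  assumes "e \<in> E"
  shows "diam d e = l e"
proof -
  obtain x y where e: "e = {x, y}" "x \<noteq> y" using card_edge[OF assms] by (meson card_2_iff)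
  then have V: "x \<in> V" "y \<in> V" using edge_subset assms by auto
  have "d x y = l e" "d y x = l e" using dist_edge[of x y] dist_commute[OF V] assms e by auto
  then show ?thesis
    using e V weight_pos[OF assms] dist_self by (intro diam_eqI[of _ _ _ x y]) auto
qed

lemma diam_vertex: "v \<in> V \<Longrightarrow> diam d {v} = 0"
  using dist_self by (intro diam_eqI[of _ _ _ v v]) auto

lemma diam_eq_0_iff:
  assumes "S \<subseteq> V" "S \<noteq> {}"
  shows "diam d S = 0 \<longleftrightarrow> (\<exists>v. S = {v})"
proof
  assume "diam d S = 0"
  then have le: "d x y \<le> 0" if "x \<in> S" "y \<in> S" for x y
    using dist_le_diam[OF finite_simplex[OF assms(1)] assms(2) that, of d] by simp
  have "x = y" if "x \<in> S" "y \<in> S" for x y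
    using le[OF that] dist_pos[of x y] that assms(1) by force
  with assms(2) show "\<exists>v. S = {v}" by blast
qed (use diam_vertex assms in auto)

lemma diam_nonneg:
  assumes "S \<subseteq> V" "S \<noteq> {}"
  shows "0 \<le> diam d S"
proof -
  obtain v where "v \<in> S" using assms by blast
  with dist_le_diam[OF finite_simplex[OF assms(1)] assms(2), of v v d] dist_self[of v] assms
  show ?thesis by auto
qed

text \<open>Every vertex outside an edge reaches one of its ends only through the other.\<close>

lemma edge_isolated:
  assumes "{u, v} \<in> E" "x \<in> V" "d x u \<le> d u v" "d x v \<le> d u v"
  shows "x \<in> {u, v}"
proof (rule ccontr)
  assume "x \<notin> {u, v}"
  note V = edge_vertices[OF assms(1)]
  have pos: "0 < d u x" "0 < d v x" using dist_pos V assms(2) \<open>x \<notin> {u, v}\<close> by auto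
  have c: "d x u = d u x" "d x v = d v x" "d v u = d u v" using dist_commute V assms(2) by auto
  from edge_orientation[OF assms(1,2)] show False
    using dist_additive[of v u x] dist_additive[of u v x] pos c assms(3,4) by linarith
qed

text \<open>In the geometric realization of the tree, the points at distance at most \<open>d p q\<close> from both \<open>p\<close>
  and \<open>q\<close> form the ball of radius \<open>d p q / 2\<close> about the midpoint of \<open>p\<close> and \<open>q\<close>; its diameter is at
  most \<open>d p q\<close>. The four-point condition gives this without the midpoint.\<close>

lemma lens_diam:
  assumes "x \<in> V" "y \<in> V" "p \<in> V" "q \<in> V"
    and "d x p \<le> d p q" "d x q \<le> d p q" "d y p \<le> d p q" "d y q \<le> d p q"
  shows "d x y \<le> d p q"
  using four_point[OF assms(1-4)] assms(5-8) by (simp add: max_def split: if_splits)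

text \<open>Let \<open>\<delta>\<close> be the diameter of \<open>S\<close>, let \<open>B\<close> be the set of vertices that can be added to \<open>S\<close> without
  increasing the diameter, and let \<open>m\<close> be the least vertex of \<open>B\<close>. The set \<open>B\<close> itself has diameter
  \<open>\<delta>\<close> and is closed under betweenness, so \<open>m\<close> is its vertex closest to the root and lies on the
  path from the root to every vertex of \<open>B\<close>.

  If \<open>S\<close> keeps its diameter without \<open>m\<close>, then \<open>S - {m}\<close> and \<open>S \<union> {m}\<close> form an apparent pair.
  Otherwise \<open>m \<in> S\<close> has distance \<open>\<delta>\<close> from some \<open>q \<in> S\<close>. Let \<open>n\<close> be the vertex next to \<open>m\<close> on
  the path to \<open>q\<close>. It differs from \<open>q\<close>, for otherwise \<open>B\<close> and \<open>S\<close> would be the edge \<open>{m, q}\<close>.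
  So \<open>n\<close> lies strictly inside a longest path of \<open>B\<close> and has distance less than \<open>\<delta>\<close> from all of \<open>B\<close>;
  adding or removing it never changes the diameter. Moreover every path from \<open>m\<close> to another vertex
  of \<open>B\<close> passes through \<open>n\<close>, so \<open>n\<close> is the second vertex of \<open>B\<close>. As \<open>m\<close> can neither be added
  nor removed, \<open>S - {n}\<close> and \<open>S \<union> {n}\<close> form an apparent pair.\<close>

theorem apparent_pair_of_non_edge:
  assumes S: "S \<subseteq> V" "S \<noteq> {}" "0 < diam d S" "S \<notin> E"
  obtains \<sigma> \<tau> where "S \<in> {\<sigma>, \<tau>}" "apparent_pair d (full_complex V) \<sigma> \<tau>"
    "diam d \<sigma> = diam d S" "diam d \<tau> = diam d S"
proof -
  note pair = that
  define \<delta> where "\<delta> = diam d S"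
  define B where "B = {x \<in> V. \<forall>s\<in>S. d x s \<le> \<delta>}"
  have finS: "finite S" and finB: "finite B" and BV: "B \<subseteq> V"
    using S finite_V finite_subset by (auto simp: B_def)
  obtain a b where ab: "a \<in> S" "b \<in> S" "d a b = \<delta>"
    using diam_attained[OF finS S(2)] unfolding \<delta>_def by blast
  have "0 < \<delta>" using S by (simp add: \<delta>_def)
  have SB: "S \<subseteq> B"
    using S(1) dist_le_diam[OF finS S(2)] by (auto simp: B_def \<delta>_def)
  have B_le: "d x y \<le> \<delta>" if "x \<in> B" "y \<in> B" for x y
    using lens_diam[of x y a b] that ab S(1) by (auto simp: B_def)
  (* every pair of vertices of B at distance \<delta> determines B *)
  have B_I: "x \<in> B" if "x \<in> V" "p' \<in> B" "q' \<in> B" "d p' q' = \<delta>" "d x p' \<le> \<delta>" "d x q' \<le> \<delta>" for x p' q'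
  proof -
    have "d x s \<le> \<delta>" if "s \<in> S" for s
    proof -
      have "s \<in> B" using that SB by blast
      then have "d s p' \<le> \<delta>" "d s q' \<le> \<delta>" using B_le \<open>p' \<in> B\<close> \<open>q' \<in> B\<close> by auto
      then show ?thesis
        using lens_diam[of x s p' q'] \<open>s \<in> B\<close> BV \<open>x \<in> V\<close> \<open>p' \<in> B\<close> \<open>q' \<in> B\<close> \<open>d p' q' = \<delta>\<close>
          \<open>d x p' \<le> \<delta>\<close> \<open>d x q' \<le> \<delta>\<close> by auto
    qed
    with \<open>x \<in> V\<close> show ?thesis by (simp add: B_def)
  qed
  have toggle: thesis
    if w: "w \<in> B" "S - {w} \<noteq> {}" "diam d (S - {w}) = \<delta>"
      and first: "\<And>x. x \<in> B \<Longrightarrow> x < w \<Longrightarrow> x \<in> S \<and> diam d (insert w S - {x}) \<noteq> \<delta>" for w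
  proof -
    let ?\<sigma> = "S - {w}" and ?\<tau> = "insert w S"
    have sub: "?\<sigma> \<subseteq> B" "?\<tau> \<subseteq> B" using w(1) SB by auto
    have \<tau>: "diam d ?\<tau> = \<delta>"
      using ab sub finS B_le by (intro diam_eqI[of _ _ _ a b]) auto
    have "apparent_pair d (full_complex V) ?\<sigma> ?\<tau>"
    proof (rule apparent_pairI[where w = w])
      fix x assume "x \<in> ?\<tau>" "diam d (?\<tau> - {x}) = diam d ?\<tau>"
      then show "w \<le> x" using first[of x] sub \<tau> by (metis not_le subsetD)
    next
      fix x assume x: "x \<in> V" "x \<notin> ?\<sigma>" "diam d (insert x ?\<sigma>) = diam d ?\<tau>"
      obtain p' q' where p': "p' \<in> ?\<sigma>" "q' \<in> ?\<sigma>" "d p' q' = \<delta>"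
        using diam_attained[of ?\<sigma> d] w finS by auto
      have "d x y \<le> \<delta>" if "y \<in> ?\<sigma>" for y
        using dist_le_diam[of "insert x ?\<sigma>" x y d] finS that x(3) \<tau> by auto
      then have "x \<in> B" using B_I[of x p' q'] p' sub x(1) by blast
      then show "w \<le> x" using first[of x] x(2) by (cases "x < w") auto
    qed (use w \<tau> sub finite_V BV in auto)
    moreover have "S \<in> {?\<sigma>, ?\<tau>}" by (cases "w \<in> S") auto
    ultimately show thesis using pair w(3) \<tau> unfolding \<delta>_def by blast
  qed
  have convex: "z \<in> B" if "x \<in> B" "y \<in> B" "z \<in> seg x y" for x y z
  proof -
    have "d z s \<le> \<delta>" if "s \<in> S" for s
    proof -
      have "s \<in> V" "d x s \<le> \<delta>" "d y s \<le> \<delta>"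
        using that S(1) \<open>x \<in> B\<close> \<open>y \<in> B\<close> by (auto simp: B_def)
      with dist_convex(1)[OF \<open>z \<in> seg x y\<close> \<open>s \<in> V\<close>] show ?thesis by linarith
    qed
    with that(3) seg_vertices show ?thesis by (auto simp: B_def)
  qed
  obtain r where r: "r \<in> V" "\<And>u w. u \<in> seg r w \<Longrightarrow> u \<le> w"
    using compatible seg_vertices unfolding compatible_order_def seg_def by blast
  define m where "m = Min B"
  have "B \<noteq> {}" using SB S(2) by blast
  then have m: "m \<in> B" "\<And>x. x \<in> B \<Longrightarrow> m \<le> x" using finB by (auto simp: m_def)
  then have "m \<in> V" using BV by blast
  have root_m: "m \<in> seg r x" if x: "x \<in> B" for x
  proof -
    obtain z where z: "z \<in> seg r m" "z \<in> seg r x" "z \<in> seg m x"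
      using median_exists[OF r(1) \<open>m \<in> V\<close>, of x] x BV by blast
    then have "z \<in> B" using convex m(1) x by blast
    then have "z = m" using m(2) r(2)[OF z(1)] by (simp add: order_antisym)
    with z show ?thesis by simp
  qed
  have nonempty: "S - {w} \<noteq> {}" for w
    using ab \<open>0 < \<delta>\<close> dist_self S(1) by (metis Diff_eq_empty_iff less_irrefl singletonD subsetD)
  show thesis
  proof (cases "diam d (S - {m}) = \<delta>")
    case True
    show thesis using toggle[OF m(1) nonempty True] m(2) by (meson not_le)
  next
    case False
    have lt: "diam d (S - {m}) < \<delta>"
      using False diam_mono[OF finS nonempty, of m d] unfolding \<delta>_def by auto
    have "m \<in> {a, b}"
    proof (rule ccontr)
      assume "m \<notin> {a, b}"
      then have "\<delta> \<le> diam d (S - {m})"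
        using dist_le_diam[OF _ nonempty, of m a b d] ab finS by auto
      with lt show False by simp
    qed
    then obtain q where q: "m \<in> S" "q \<in> S" "d m q = \<delta>"
      using ab dist_commute S(1) by (metis insert_iff singletonD subsetD)
    then have "q \<in> V" "q \<in> B" "m \<noteq> q" using S(1) SB dist_self[of m] \<open>0 < \<delta>\<close> \<open>m \<in> V\<close> by auto
    obtain xs where xs: "path V E m xs q" using path_exists \<open>m \<in> V\<close> \<open>q \<in> V\<close> by meson
    then obtain n ys where n: "xs = m # n # ys"
      using \<open>m \<noteq> q\<close> by (cases xs; cases "tl xs") (auto simp: path_def)
    then have edge: "{m, n} \<in> E" and seg_n: "n \<in> seg m q"
      using xs seg_eq[OF xs] by (auto simp: path_def)
    note V = edge_vertices[OF edge] \<open>q \<in> V\<close>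
    have "n \<noteq> q"
    proof
      assume "n = q"
      then have "x \<in> {m, n}" if "x \<in> B" for x
        using edge_isolated[OF edge, of x] that q \<open>m \<in> B\<close> B_le BV SB by auto
      then have "S = {m, n}" using SB q \<open>n = q\<close> by blast
      with edge S(4) show False by simp
    qed
    have "n \<in> B" using convex[OF m(1) \<open>q \<in> B\<close> seg_n] .
    have inner: "d n y < \<delta>" if "y \<in> B" for y
      using dist_convex(2)[OF seg_n, of y] B_le[OF \<open>m \<in> B\<close> that] B_le[OF \<open>q \<in> B\<close> that]
        that BV V \<open>n \<noteq> q\<close> by fastforce
    have second: "n \<le> x" if x: "x \<in> B" "x \<noteq> m" for x
    proof -
      have "n \<in> seg m x"
      proof (rule ccontr)
        assume not: "n \<notin> seg m x"
        have "x \<in> V" using x BV by blast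
        then have "m \<in> seg n x" using edge_orientation[OF edge] not by blast
        moreover have "n \<in> seg x q" using seg_cover[OF \<open>x \<in> V\<close>] seg_n not by blast
        ultimately have "d x q = d x n + d n q" "d n x = d n m + d m x" "d m q = d m n + d n q"
          using seg_n by (auto intro: dist_additive)
        moreover have "d n x = d x n" "d n m = d m n" "0 < d m x"
          using dist_commute dist_pos[of m x] V \<open>x \<in> V\<close> x(2) by auto
        ultimately have "\<delta> < d x q" using q(3) by linarith
        with B_le[OF x(1) \<open>q \<in> B\<close>] show False by simp
      qed
      then have "n \<in> seg r x" using seg_mono[OF root_m[OF x(1)]] by blast
      then show ?thesis by (rule r(2))
    qed
    have n_free: "diam d (S - {n}) = \<delta>"
      using q V \<open>n \<noteq> q\<close> finS SB B_le by (intro diam_eqI[of _ _ _ m q]) auto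
    have m_needed: "diam d (insert n S - {m}) < \<delta>"
    proof -
      have "finite (S - {m})" using finS by simp
      then have S_lt: "d x y < \<delta>" if "x \<in> S - {m}" "y \<in> S - {m}" for x y
        using lt that diam_less_iff[OF _ nonempty, of m d \<delta>] by blast
      have n_lt: "d n y < \<delta>" "d y n < \<delta>" if "y \<in> B" for y
        using inner[OF that] dist_commute[of n y] that BV V by auto
      have "d x y < \<delta>" if "x \<in> insert n S - {m}" "y \<in> insert n S - {m}" for x y
        using that S_lt[of x y] n_lt[of x] n_lt[of y] SB \<open>n \<in> B\<close> by blast
      moreover have "finite (insert n S - {m})" "insert n S - {m} \<noteq> {}" using finS V by auto
      ultimately show ?thesis by (simp add: diam_less_iff)
    qed
    show thesis
    proof (rule toggle[OF \<open>n \<in> B\<close> nonempty n_free])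
      fix x assume "x \<in> B" "x < n"
      then have "x = m" using second[of x] by (meson not_le)
      with q(1) m_needed show "x \<in> S \<and> diam d (insert n S - {x}) \<noteq> \<delta>" by simp
    qed
  qed
qed

text \<open>An edge has no cofacet of the same diameter, and its facets have diameter zero.\<close>

lemma edge_not_paired:
  assumes "apparent_pair d (full_complex V) \<sigma> \<tau>" "diam d \<sigma> = diam d \<tau>"
  shows "\<sigma> \<notin> E" "\<tau> \<notin> E"
proof -
  have V: "\<sigma> \<subseteq> V" "\<tau> \<subseteq> V" "\<sigma> \<noteq> {}" "\<tau> \<noteq> {}" and f: "\<sigma> \<subseteq> \<tau>" "card \<tau> = card \<sigma> + 1"
    using assms by (auto simp: apparent_pair_def full_complex_def facet_def)
  show "\<tau> \<notin> E"
  proof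
    assume \<tau>: "\<tau> \<in> E"
    then have "card \<sigma> = 1" using f card_edge by fastforce
    then have "diam d \<sigma> = 0" using diam_eq_0_iff V by (metis card_1_singletonE)
    with \<tau> diam_edge weight_pos assms(2) show False by force
  qed
  show "\<sigma> \<notin> E"
  proof
    assume \<sigma>: "\<sigma> \<in> E"
    then obtain u v where uv: "\<sigma> = {u, v}" by (meson card_2_iff card_edge)
    obtain x where x: "x \<in> \<tau>" "x \<notin> \<sigma>" using f by (metis n_not_Suc_n Suc_eq_plus1 subsetI subset_antisym)
    have "d y z \<le> d u v" if "y \<in> \<tau>" "z \<in> \<tau>" for y z
      using dist_le_diam[OF finite_simplex V(4) that, of d] V diam_edge[OF \<sigma>] dist_edge \<sigma> uv assms(2)
      by metis
    then have "x \<in> {u, v}" using edge_isolated[of u v x] x f V uv \<sigma> by blast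
    with x uv show False by simp
  qed
qed


section \<open>The collapses of the Rips filtration\<close>

lemma Rips_subset_full: "Rips d V t \<subseteq> full_complex V"
  by (auto simp: Rips_def full_complex_def)

lemma Rips_mono: "t \<le> u \<Longrightarrow> Rips d V t \<subseteq> Rips d V u"
  by (auto simp: Rips_def)

lemma simplicial_complex_full: "simplicial_complex (full_complex V)"
  using finite_simplex by (auto simp: simplicial_complex_def full_complex_def)

lemma simplicial_complex_Rips: "simplicial_complex (Rips d V t)"
  unfolding simplicial_complex_def
proof (intro ballI conjI allI impI)
  fix \<sigma> \<rho> assume \<sigma>: "\<sigma> \<in> Rips d V t"
  then show fin: "finite \<sigma>" "\<sigma> \<noteq> {}" using finite_simplex by (auto simp: Rips_def)
  assume "\<rho> \<noteq> {} \<and> \<rho> \<subseteq> \<sigma>"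
  with diam_mono[OF fin(1), of \<rho> d] \<sigma> show "\<rho> \<in> Rips d V t" by (auto simp: Rips_def)
qed

lemma simplicial_complex_subforest: "simplicial_complex (subforest V E l t)"
  unfolding simplicial_complex_def
proof (intro ballI conjI allI impI)
  fix \<sigma> \<rho> assume \<sigma>: "\<sigma> \<in> subforest V E l t"
  then obtain u v where uv: "\<sigma> = {u, v}" "u \<in> V" "v \<in> V"
  proof (cases "\<sigma> \<in> E")
    case True
    then obtain u v where "\<sigma> = {u, v}" by (meson card_edge card_2_iff)
    with edge_subset[OF True] show thesis by (intro that) auto
  next
    case False
    with \<sigma> obtain v where "\<sigma> = {v}" "v \<in> V" by (auto simp: subforest_def)
    then show thesis by (intro that[of v v]) auto
  qed
  then show "finite \<sigma>" "\<sigma> \<noteq> {}" by auto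
  assume "\<rho> \<noteq> {} \<and> \<rho> \<subseteq> \<sigma>"
  then have "\<rho> = \<sigma> \<or> \<rho> = {u} \<or> \<rho> = {v}" using uv(1) by auto
  with \<sigma> uv show "\<rho> \<in> subforest V E l t" by (auto simp: subforest_def)
qed

lemma subforest_subset_Rips: "0 < t \<Longrightarrow> subforest V E l t \<subseteq> Rips d V t"
  using diam_vertex diam_edge edge_subset card_edge[of "{}"]
  by (auto simp: subforest_def Rips_def)

text \<open>Both simplices of the apparent pair of a non-edge have the diameter of this simplex and are
  non-edges themselves; so a set of non-edges described by the diameter is a union of
  apparent pairs.\<close>

lemma induces_collapse_non_edges:
  assumes sc: "simplicial_complex K" "simplicial_complex L" "K \<subseteq> full_complex V" "L \<subseteq> K"
    and diff: "K - L = {S \<in> full_complex V. diam d S \<in> D \<and> S \<notin> E}" and D: "D \<subseteq> {0<..}"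
  shows "induces_collapse (full_complex V) (apparent_pairs_gradient d V) K L"
proof -
  let ?W = "{{\<sigma>, \<tau>} |\<sigma> \<tau>. apparent_pair d (full_complex V) \<sigma> \<tau> \<and> diam d \<sigma> = diam d \<tau> \<and> diam d \<sigma> \<in> D}"
  have W: "?W \<subseteq> apparent_pairs_gradient d V" by (auto simp: apparent_pairs_gradient_def)
  have "K - L = \<Union> ?W"
  proof
    show "K - L \<subseteq> \<Union> ?W"
    proof
      fix S assume "S \<in> K - L"
      then have S: "S \<subseteq> V" "S \<noteq> {}" "0 < diam d S" "S \<notin> E" "diam d S \<in> D"
        using diff D by (auto simp: full_complex_def)
      obtain \<sigma> \<tau> where st: "S \<in> {\<sigma>, \<tau>}" "apparent_pair d (full_complex V) \<sigma> \<tau>"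
        "diam d \<sigma> = diam d S" "diam d \<tau> = diam d S"
        using apparent_pair_of_non_edge[OF S(1-4)] .
      then have "diam d \<sigma> = diam d \<tau>" "diam d \<sigma> \<in> D" using S(5) by simp_all
      with st(2) have "{\<sigma>, \<tau>} \<in> ?W" by blast
      with st(1) show "S \<in> \<Union> ?W" by (rule UnionI[rotated])
    qed
    show "\<Union> ?W \<subseteq> K - L"
    proof
      fix S assume "S \<in> \<Union> ?W"
      then obtain \<sigma> \<tau> where st: "S \<in> {\<sigma>, \<tau>}" "apparent_pair d (full_complex V) \<sigma> \<tau>"
        "diam d \<sigma> = diam d \<tau>" "diam d \<sigma> \<in> D" by blast
      then have "S \<notin> E" using edge_not_paired by blast
      moreover have "S \<in> full_complex V" using st by (auto simp: apparent_pair_def)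
      moreover have "diam d S \<in> D" using st by auto
      ultimately show "S \<in> K - L" using diff by blast
    qed
  qed
  moreover from this have "collapses K L"
    using sc by (intro collapses_along_apparent_pairs[OF finite_V sc(3) W])
      (auto dest: simplicial_complexD)
  ultimately show ?thesis
    unfolding induces_collapse_def subcomplex_def
    using sc simplicial_complex_full discrete_gradient_apparent_pairs[OF finite_V, of d]
      finite_full_complex[OF finite_V] W by blast
qed

theorem Rips_collapses_to_Rips:
  assumes "0 < t" "t < u" "\<forall>e\<in>E. l e \<notin> {t<..u}"
  shows "induces_collapse (full_complex V) (apparent_pairs_gradient d V) (Rips d V u) (Rips d V t)"
proof (rule induces_collapse_non_edges)
  show "Rips d V u - Rips d V t = {S \<in> full_complex V. diam d S \<in> {t<..u} \<and> S \<notin> E}"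
    using assms(3) diam_edge by (auto simp: Rips_def full_complex_def)
qed (use assms simplicial_complex_Rips Rips_subset_full Rips_mono in auto)

theorem Rips_collapses_to_subforest:
  assumes "0 < t"
  shows "induces_collapse (full_complex V) (apparent_pairs_gradient d V) (Rips d V t)
    (subforest V E l t)"
proof (rule induces_collapse_non_edges)
  have "S \<in> subforest V E l t \<longleftrightarrow> \<not> (0 < diam d S \<and> S \<notin> E)"
    if S: "S \<subseteq> V" "S \<noteq> {}" "diam d S \<le> t" for S
  proof -
    have "(\<exists>v\<in>V. S = {v}) \<longleftrightarrow> \<not> 0 < diam d S"
      using diam_eq_0_iff[OF S(1,2)] diam_nonneg[OF S(1,2)] S(1) by auto
    moreover have "S \<in> E \<longleftrightarrow> S \<in> E \<and> l S \<le> t" using diam_edge S by auto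
    ultimately show ?thesis unfolding subforest_def by blast
  qed
  then show "Rips d V t - subforest V E l t = {S \<in> full_complex V. diam d S \<in> {0<..t} \<and> S \<notin> E}"
    by (auto simp: Rips_def full_complex_def)
qed (use assms simplicial_complex_Rips simplicial_complex_subforest Rips_subset_full
    subforest_subset_Rips in auto)


section \<open>Persistent homology of tree metrics\<close>

text \<open>A forest has simplices of positive dimension only in dimension one, and there it has no nonzero
  cycle: in the support of a nonzero \<open>1\<close>-chain let \<open>w\<close> be a vertex of maximal distance
  from a fixed root. Only the edge from \<open>w\<close> towards the root can meet \<open>w\<close> within the support, so
  \<open>w\<close> occurs in the boundary.\<close>

lemma acyclic_subforest:
  assumes "0 < p"
  shows "acyclic_in_degree TYPE('k::comm_ring_1) p (subforest V E l t)"
  unfolding acyclic_in_degree_def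
proof
  fix z :: "'a set \<Rightarrow> 'k"
  assume "z \<in> carrier (cycle_group (subforest V E l t) p)"
  then have z: "z \<in> carrier (chain_group (subforest V E l t) p)" "boundary z = (\<lambda>_. 0)"
    by (auto simp: cycle_iff)
  have supp: "e \<in> E" if "z e \<noteq> 0" for e
  proof -
    have "e \<in> subforest V E l t" "card e = p + 1" using z(1) that by (auto simp: chain_group_def)
    then show ?thesis using assms by (auto simp: subforest_def)
  qed
  have "z = (\<lambda>_. 0)"
  proof (rule ccontr)
    assume "z \<noteq> (\<lambda>_. 0)"
    then obtain e0 where e0: "z e0 \<noteq> 0" by blast
    obtain r where r: "r \<in> V" using tree by (auto simp: finite_tree_def)
    let ?N = "\<Union> {e. z e \<noteq> 0}"
    have NV: "?N \<subseteq> V" using supp edge_subset by blast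
    have "e0 \<noteq> {}" using supp[OF e0] card_edge by fastforce
    then have "?N \<noteq> {}" using e0 by blast
    moreover have finN: "finite ?N" using NV finite_simplex by blast
    ultimately have "Max ((\<lambda>w. d w r) ` ?N) \<in> (\<lambda>w. d w r) ` ?N" by (intro Max_in) auto
    then obtain w where w: "w \<in> ?N" "d w r = Max ((\<lambda>w. d w r) ` ?N)"
      by (metis (no_types, lifting) imageE)
    have far: "d u r \<le> d w r" if "u \<in> ?N" for u
      using w(2) finN that by simp
    have up: "u \<in> seg w r" if "z {w, u} \<noteq> 0" for u
    proof -
      have edge: "{w, u} \<in> E" using supp that .
      have "w \<notin> seg u r"
      proof
        assume "w \<in> seg u r"
        then have "d u r = d u w + d w r" by (rule dist_additive)
        moreover have "0 < d u w" using dist_pos edge_vertices[OF edge] by blast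
        moreover have "d u r \<le> d w r" using that by (intro far) auto
        ultimately show False by linarith
      qed
      with edge_orientation[OF edge r] show ?thesis by blast
    qed
    have other: "\<exists>u. f = {w, u}" if "w \<in> f" "z f \<noteq> 0" for f
    proof -
      have "card f = 2" using supp[OF that(2)] card_edge by blast
      then obtain a b where "f = {a, b}" by (meson card_2_iff)
      with that(1) show ?thesis by blast
    qed
    obtain e where e: "z e \<noteq> 0" "w \<in> e" using w by blast
    have only: "f = e" if f: "z f \<noteq> 0" "w \<in> f" for f
    proof -
      obtain u v where uv: "e = {w, u}" "f = {w, v}" using other f e by meson
      then have "u = v" using parent_unique[of w u v r] up supp e f by blast
      with uv show ?thesis by simp
    qed
    have f: "facet {w} e" using e supp[OF e(1)] card_edge by (simp add: facet_def)
    have fin: "finite {\<tau>. z \<tau> \<noteq> 0}" using z(1) by (rule finite_support)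
    have "boundary z {w} = (\<Sum>\<tau>\<in>{e}. z \<tau> * incidence \<tau> {w})"
      unfolding boundary_def
    proof (rule sum.mono_neutral_right[OF fin])
      show "\<forall>\<tau>\<in>{\<tau>. z \<tau> \<noteq> 0} - {e}. z \<tau> * incidence \<tau> {w} = 0"
        using only by (auto simp: incidence_def facet_def)
    qed (use e in auto)
    then have "z e * incidence e {w} * incidence e {w} = 0" using z(2) by simp
    then show False using incidence_square[OF f, where ?'k = 'k] e by (simp add: mult.assoc)
  qed
  then show "z \<in> boundaries (subforest V E l t) p" using zero_boundary by simp
qed

lemma acyclic_Rips:
  assumes "0 < p"
  shows "acyclic_in_degree TYPE('k::comm_ring_1) p (Rips d V t)"
proof (cases "0 < t")
  case True
  have "finite (Rips d V t)"
    using finite_subset[OF Rips_subset_full finite_full_complex[OF finite_V]] .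
  with Rips_collapses_to_subforest[OF True] acyclic_subforest[OF assms] show ?thesis
    by (intro acyclic_collapses[OF _ _ simplicial_complex_Rips]) (auto simp: induces_collapse_def)
next
  case False
  have one: "card S = 1" if "S \<in> Rips d V t" for S
  proof -
    have S: "S \<subseteq> V" "S \<noteq> {}" "diam d S \<le> t" using that by (auto simp: Rips_def)
    then have "diam d S = 0" using diam_nonneg[OF S(1,2)] False by linarith
    then show ?thesis using diam_eq_0_iff[OF S(1,2)] by auto
  qed
  have "z = (\<lambda>_. 0)" if "z \<in> carrier (cycle_group (Rips d V t) p)" for z :: "'a set \<Rightarrow> 'k"
    using that one assms by (fastforce simp: cycle_iff chain_group_def)
  then show ?thesis unfolding acyclic_in_degree_def using zero_boundary by blast
qed

end


theorem theorem5:
  fixes V :: "'a::linorder set" and E :: "'a set set" and l :: "'a set \<Rightarrow> real"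
    and d :: "'a \<Rightarrow> 'a \<Rightarrow> real"
  defines "d \<equiv> tree_dist V E l"
  assumes "finite_tree V E"
    and "\<forall>e\<in>E. l e > 0"
    and "compatible_order V E"
  shows "(\<forall>u t. u > t \<and> t > 0 \<and> (\<forall>e\<in>E. l e \<notin> {t<..u}) \<longrightarrow>
            induces_collapse (full_complex V) (apparent_pairs_gradient d V) (Rips d V u) (Rips d V t) \<and>
            induces_collapse (full_complex V) (apparent_pairs_gradient d V) (Rips d V t) (subforest V E l t))
       \<and> (\<forall>p>0. \<forall>s t. s \<le> t \<longrightarrow>
            trivial_group (persistent_homology_group (Rips d V) p s t
              :: ('a set \<Rightarrow> 'k::comm_ring_1) set monoid))"
proof -
  interpret T: ordered_weighted_tree V E l
    using assms(2-4) by unfold_locales auto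
  show ?thesis
    unfolding d_def
  proof (intro conjI allI impI)
    fix u t assume ut: "u > t \<and> t > 0 \<and> (\<forall>e\<in>E. l e \<notin> {t<..u})"
    show "induces_collapse (full_complex V) (apparent_pairs_gradient (tree_dist V E l) V)
        (Rips (tree_dist V E l) V u) (Rips (tree_dist V E l) V t)"
      using ut by (intro T.Rips_collapses_to_Rips) auto
    show "induces_collapse (full_complex V) (apparent_pairs_gradient (tree_dist V E l) V)
        (Rips (tree_dist V E l) V t) (subforest V E l t)"
      using ut by (intro T.Rips_collapses_to_subforest) auto
  next
    fix p :: nat and s t :: real assume "0 < p" "s \<le> t"
    then show "trivial_group (persistent_homology_group (Rips (tree_dist V E l) V) p s t
        :: ('a set \<Rightarrow> 'k) set monoid)"
      by (intro trivial_persistent_homology T.Rips_mono T.acyclic_Rips)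
  qed
qed

end
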